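(* Let $1<p<\infty$, $\alpha>-1$, and let $q=\frac{p}{p-1}$. Then the operator norm of the maximal Bergman projection $P_\alpha^\sharp$ on $L^p_\alpha(\mathbb{D})$ is $$\|P_\alpha^\sharp\|_{p,\alpha}=\frac{(1+\alpha)\,\Gamma\left(\frac{1+\alpha}{p}\right)\Gamma\left(\frac{1+\alpha}{q}\right)}{\Gamma^2\left(\frac{2+\alpha}{2}\right)}.$$
   Context: $\mathbb{D}$ is the open unit disk in $\mathbb{C}$ and $dA(z)=\pi^{-1}dx\,dy$ is normalized Lebesgue area measure. For $\alpha>-1$, $dA_\alpha(z)=(1+\alpha)(1-|z|^2)^\alpha dA(z)$. $L^p_\alpha(\mathbb{D})$ is the space of (complex-valued) Lebesgue measurable functions $f$ on $\mathbb{D}$ with $\|f\|_{p,\alpha}:=\left(\int_{\mathbb{D}}|f|^p\,dA_\alpha\right)^{1/p}<\infty$. The maximal Bergman projection is $$P_\alpha^\sharp f(z)=\int_{\mathbb{D}}\frac{f(w)}{|1-z\bar w|^{2+\alpha}}\,dA_\alpha(w),\qquad z\in\mathbb{D},$$ and $\|P_\alpha^\sharp\|_{p,\alpha}:=\sup\{\|P_\alpha^\sharp f\|_{p,\alpha}/\|f\|_{p,\alpha}: f\in L^p_\alpha(\mathbb{D}),\ f\ne0\}$. $\Gamma$ is the Gamma function and $\Gamma^2(x)=\Gamma(x)^2$. *)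

theory Defs
  imports "HOL-Analysis.Analysis"
begin

definition disk_area :: "complex measure" where
  "disk_area = density (lebesgue_on (ball 0 1)) (\<lambda>_. ennreal (1 / pi))"

definition weighted_disk_area :: "real \<Rightarrow> complex measure" where
  "weighted_disk_area \<alpha> =
     density disk_area (\<lambda>z. ennreal ((1 + \<alpha>) * (1 - (cmod z)\<^sup>2) powr \<alpha>))"

text \<open>The norm is extended-valued, so that a function outside the space gets norm \<open>\<infinity>\<close>;
  the case distinction is the \<open>p\<close>-th root on \<open>[0, \<infinity>]\<close>.\<close>

definition disk_Lp_norm :: "real \<Rightarrow> real \<Rightarrow> (complex \<Rightarrow> complex) \<Rightarrow> ennreal" where
  "disk_Lp_norm p \<alpha> f =
     (let I = (\<integral>\<^sup>+ z. ennreal (cmod (f z) powr p) \<partial>weighted_disk_area \<alpha>)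
      in if I = \<infinity> then \<infinity> else ennreal (enn2real I powr (1 / p)))"

definition disk_Lp :: "real \<Rightarrow> real \<Rightarrow> (complex \<Rightarrow> complex) set" where
  "disk_Lp p \<alpha> =
     {f. f \<in> borel_measurable (lebesgue_on (ball 0 1)) \<and> disk_Lp_norm p \<alpha> f < \<infinity>}"

definition maximal_bergman :: "real \<Rightarrow> (complex \<Rightarrow> complex) \<Rightarrow> complex \<Rightarrow> complex" where
  "maximal_bergman \<alpha> f z =
     (LINT w|weighted_disk_area \<alpha>. f w / of_real (cmod (1 - z * cnj w) powr (2 + \<alpha>)))"

text \<open>Elements of the space are functions up to almost everywhere equality, so \<open>f \<noteq> 0\<close> means
  that \<open>f\<close> is not almost everywhere zero on the disk. The supremum is taken in \<open>[0, \<infinity>]\<close> and is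
  finite only if the operator is bounded.\<close>

definition maximal_bergman_norm :: "real \<Rightarrow> real \<Rightarrow> ennreal" where
  "maximal_bergman_norm p \<alpha> =
     (SUP f \<in> {f \<in> disk_Lp p \<alpha>. \<not> (AE z in lebesgue_on (ball 0 1). f z = 0)}.
        disk_Lp_norm p \<alpha> (maximal_bergman \<alpha> f) / disk_Lp_norm p \<alpha> f)"

end

theory Submission
  imports Defs
begin

text \<open>
  Put \<open>a = (2 + \<alpha>) / 2\<close>. The kernel is the squared modulus of a power \<open>-a\<close>, so by the binomial series and
  the orthogonality of monomials, its integral against \<open>(1 - \<bar>w\<bar>\<^sup>2)\<close> to the power \<open>-s\<close> is a power series in
  \<open>\<bar>z\<bar>\<^sup>2\<close>. The quotient of its coefficients by those of \<open>(1 - \<bar>z\<bar>\<^sup>2)\<close> to the power \<open>-s\<close> is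
  \<open>(1 + \<alpha>) \<Gamma>(s) \<Gamma>(1 + \<alpha> - s) / \<Gamma>(a)\<^sup>2\<close> times \<open>\<Gamma>(n + a)\<^sup>2 / (\<Gamma>(n + 2a - s) \<Gamma>(n + s))\<close>, and the latter factor
  increases to \<open>1\<close>. With \<open>s = (1 + \<alpha>) / p\<close> and \<open>s = (1 + \<alpha>) / q\<close> this gives both conditions of Schur's
  test with the claimed constant. For sharpness, apply the operator to these radial powers themselves and let
  \<open>s\<close> increase to \<open>(1 + \<alpha>) / p\<close>: their norms blow up, so only the behaviour of the coefficients for
  large \<open>n\<close> matters.
\<close>

subsection \<open>Rotation-invariant integrals over the disk\<close>

text \<open>Boxes determine Lebesgue measure, and the image of the product measure assigns each box
  the product of its side lengths. This makes Tonelli available in the two real coordinates.\<close>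

lemma lborel_complex_eq_distr:
  "(lborel :: complex measure) = distr (lborel \<Otimes>\<^sub>M lborel) borel (\<lambda>(x, y). Complex x y)"
proof (rule lborel_eqI)
  have meas [measurable]: "(\<lambda>(x, y). Complex x y) \<in> borel_measurable (lborel \<Otimes>\<^sub>M lborel)"
    unfolding Complex_eq by (simp add: case_prod_unfold)
  fix l u :: complex
  assume le: "\<And>b. b \<in> Basis \<Longrightarrow> l \<bullet> b \<le> u \<bullet> b"
  have le': "Re l \<le> Re u" "Im l \<le> Im u"
    using le[of 1] le[of \<i>] by (auto simp: Basis_complex_def)
  have "(\<lambda>(x, y). Complex x y) -` box l u \<inter> space (lborel \<Otimes>\<^sub>M lborel) =
      {Re l<..<Re u} \<times> {Im l<..<Im u}"
    by (auto simp: box_def Basis_complex_def space_pair_measure)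
  then have "emeasure (distr (lborel \<Otimes>\<^sub>M lborel) borel (\<lambda>(x, y). Complex x y)) (box l u) =
      ennreal (Re u - Re l) * ennreal (Im u - Im l)"
    using le' by (simp add: emeasure_distr lborel.emeasure_pair_measure_Times)
  also have "\<dots> = ennreal (\<Prod>b\<in>Basis. (u - l) \<bullet> b)"
    using le' by (simp add: Basis_complex_def ennreal_mult')
  finally show "emeasure (distr (lborel \<Otimes>\<^sub>M lborel) borel (\<lambda>(x, y). Complex x y)) (box l u) =
      ennreal (\<Prod>b\<in>Basis. (u - l) \<bullet> b)" .
qed simp

lemma nn_integral_lborel_complex:
  assumes [measurable]: "f \<in> borel_measurable borel"
  shows "(\<integral>\<^sup>+w. f w \<partial>lborel) = (\<integral>\<^sup>+x. \<integral>\<^sup>+y. f (Complex x y) \<partial>lborel \<partial>lborel)"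
    and "(\<integral>\<^sup>+w. f w \<partial>lborel) = (\<integral>\<^sup>+y. \<integral>\<^sup>+x. f (Complex x y) \<partial>lborel \<partial>lborel)"
proof -
  have meas [measurable]: "(\<lambda>(x, y). Complex x y) \<in> borel_measurable (lborel \<Otimes>\<^sub>M lborel)"
    unfolding Complex_eq by (simp add: case_prod_unfold)
  have "(\<integral>\<^sup>+w. f w \<partial>lborel) = (\<integral>\<^sup>+z. f (case z of (x, y) \<Rightarrow> Complex x y) \<partial>(lborel \<Otimes>\<^sub>M lborel))"
    by (subst lborel_complex_eq_distr) (rule nn_integral_distr; simp)
  moreover have m: "(\<lambda>z. f (case z of (x, y) \<Rightarrow> Complex x y)) \<in> borel_measurable (lborel \<Otimes>\<^sub>M lborel)"
    by measurable
  ultimately show "(\<integral>\<^sup>+w. f w \<partial>lborel) = (\<integral>\<^sup>+x. \<integral>\<^sup>+y. f (Complex x y) \<partial>lborel \<partial>lborel)"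
    and "(\<integral>\<^sup>+w. f w \<partial>lborel) = (\<integral>\<^sup>+y. \<integral>\<^sup>+x. f (Complex x y) \<partial>lborel \<partial>lborel)"
    using lborel.nn_integral_fst[OF m] lborel_pair.nn_integral_snd[OF m]
    by (simp_all add: case_prod_unfold)
qed

text \<open>On each line parallel to the direction of the shear the map is a translation, so
  integrating first along that line reduces the claim to translation invariance in one
  dimension.\<close>

lemma nn_integral_lborel_shear:
  fixes f :: "complex \<Rightarrow> ennreal" and t :: real
  assumes [measurable]: "f \<in> borel_measurable borel"
  shows "(\<integral>\<^sup>+w. f (w + of_real (t * Im w)) \<partial>lborel) = (\<integral>\<^sup>+w. f w \<partial>lborel)"
    and "(\<integral>\<^sup>+w. f (w + \<i> * of_real (t * Re w)) \<partial>lborel) = (\<integral>\<^sup>+w. f w \<partial>lborel)"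
proof -
  have [measurable]: "Re \<in> borel_measurable borel" "Im \<in> borel_measurable borel"
    by (intro borel_measurable_continuous_onI continuous_intros)+
  have "(\<integral>\<^sup>+w. f (w + of_real (t * Im w)) \<partial>lborel)
      = (\<integral>\<^sup>+y. \<integral>\<^sup>+x. f (Complex (t * y + 1 * x) y) \<partial>lborel \<partial>lborel)"
    by (subst nn_integral_lborel_complex(2)) (auto simp: Complex_eq algebra_simps)
  also have "\<dots> = (\<integral>\<^sup>+y. \<integral>\<^sup>+x. f (Complex x y) \<partial>lborel \<partial>lborel)"
  proof (rule nn_integral_cong)
    fix y
    have "(\<lambda>x. f (Complex x y)) \<in> borel_measurable borel"
      unfolding Complex_eq by measurable
    from nn_integral_real_affine[OF this, of 1 "t * y"]
    show "(\<integral>\<^sup>+x. f (Complex (t * y + 1 * x) y) \<partial>lborel) = (\<integral>\<^sup>+x. f (Complex x y) \<partial>lborel)"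
      by simp
  qed
  also have "\<dots> = (\<integral>\<^sup>+w. f w \<partial>lborel)"
    by (rule nn_integral_lborel_complex(2)[symmetric]) simp
  finally show "(\<integral>\<^sup>+w. f (w + of_real (t * Im w)) \<partial>lborel) = (\<integral>\<^sup>+w. f w \<partial>lborel)" .
  have "(\<integral>\<^sup>+w. f (w + \<i> * of_real (t * Re w)) \<partial>lborel)
      = (\<integral>\<^sup>+x. \<integral>\<^sup>+y. f (Complex x (t * x + 1 * y)) \<partial>lborel \<partial>lborel)"
    by (subst nn_integral_lborel_complex(1)) (auto simp: Complex_eq algebra_simps)
  also have "\<dots> = (\<integral>\<^sup>+x. \<integral>\<^sup>+y. f (Complex x y) \<partial>lborel \<partial>lborel)"
  proof (rule nn_integral_cong)
    fix x
    have "(\<lambda>y. f (Complex x y)) \<in> borel_measurable borel"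
      unfolding Complex_eq by measurable
    from nn_integral_real_affine[OF this, of 1 "t * x"]
    show "(\<integral>\<^sup>+y. f (Complex x (t * x + 1 * y)) \<partial>lborel) = (\<integral>\<^sup>+y. f (Complex x y) \<partial>lborel)"
      by simp
  qed
  also have "\<dots> = (\<integral>\<^sup>+w. f w \<partial>lborel)"
    by (rule nn_integral_lborel_complex(1)[symmetric]) simp
  finally show "(\<integral>\<^sup>+w. f (w + \<i> * of_real (t * Re w)) \<partial>lborel) = (\<integral>\<^sup>+w. f w \<partial>lborel)" .
qed

text \<open>A rotation by an angle that is not a multiple of \<open>\<pi>\<close> is a product of three shears.\<close>

lemma nn_integral_lborel_rotation:
  fixes f :: "complex \<Rightarrow> ennreal"
  assumes [measurable]: "f \<in> borel_measurable borel" and c: "cmod c = 1" "Im c \<noteq> 0"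
  shows "(\<integral>\<^sup>+w. f (c * w) \<partial>lborel) = (\<integral>\<^sup>+w. f w \<partial>lborel)"
proof -
  have [measurable]: "Re \<in> borel_measurable borel" "Im \<in> borel_measurable borel"
    by (intro borel_measurable_continuous_onI continuous_intros)+
  \<comment> \<open>For \<open>c = cis \<theta>\<close> the horizontal shear has parameter
    \<open>- tan (\<theta> / 2)\<close> and the vertical one \<open>sin \<theta>\<close>. The
    division is where \<open>Im c \<noteq> 0\<close> enters.\<close>
  define a where "a = (Re c - 1) / Im c"
  define b where "b = Im c"
  define S where "S = (\<lambda>w. w + complex_of_real (a * Im w))"
  define T where "T = (\<lambda>w. w + \<i> * complex_of_real (b * Re w))"
  have [measurable]: "S \<in> borel_measurable borel" "T \<in> borel_measurable borel"
    unfolding S_def T_def by measurable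
  have sq: "(Re c)\<^sup>2 + (Im c)\<^sup>2 = 1"
    using c(1) by (simp add: cmod_def)
  have ab: "1 + a * b = Re c"
    using c(2) by (simp add: a_def b_def)
  have "a * (1 + Re c) = ((Re c)\<^sup>2 - 1) / Im c"
    by (simp add: a_def power2_eq_square algebra_simps)
  also have "\<dots> = - (Im c)\<^sup>2 / Im c"
    by (simp only: flip: sq) simp
  also have "\<dots> = - Im c"
    using c(2) by (simp add: power2_eq_square)
  finally have a: "a * (1 + Re c) = - Im c" .
  have "S (T (S w)) = c * w" for w
  proof (rule complex_eqI)
    have "Re (S (T (S w))) = (1 + a * b) * Re w + a * (1 + (1 + a * b)) * Im w"
      by (simp add: S_def T_def algebra_simps)
    also have "\<dots> = Re (c * w)"
      unfolding ab a by simp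
    finally show "Re (S (T (S w))) = Re (c * w)" .
    have "Im (S (T (S w))) = b * Re w + (1 + a * b) * Im w"
      by (simp add: S_def T_def algebra_simps)
    also have "\<dots> = Im (c * w)"
      unfolding ab by (simp add: b_def)
    finally show "Im (S (T (S w))) = Im (c * w)" .
  qed
  then have "(\<integral>\<^sup>+w. f (c * w) \<partial>lborel) = (\<integral>\<^sup>+w. f (S (T (S w))) \<partial>lborel)"
    by simp
  also have "\<dots> = (\<integral>\<^sup>+w. f (S (T w)) \<partial>lborel)"
    using nn_integral_lborel_shear(1)[of "\<lambda>w. f (S (T w))" a] by (simp add: S_def)
  also have "\<dots> = (\<integral>\<^sup>+w. f (S w) \<partial>lborel)"
    using nn_integral_lborel_shear(2)[of "\<lambda>w. f (S w)" b] by (simp add: T_def)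
  also have "\<dots> = (\<integral>\<^sup>+w. f w \<partial>lborel)"
    using nn_integral_lborel_shear(1)[of f a] by (simp add: S_def)
  finally show ?thesis .
qed

section \<open>Measures on the disk with a radial density\<close>

definition radial_measure :: "(real \<Rightarrow> ennreal) \<Rightarrow> complex measure" where
  "radial_measure G =
     density lborel (\<lambda>w. indicator (ball 0 1) w * (ennreal (1 / pi) * G ((cmod w)\<^sup>2)))"

lemma sets_radial_measure [measurable_cong, simp]: "sets (radial_measure G) = sets borel"
  and space_radial_measure [simp]: "space (radial_measure G) = UNIV"
  by (simp_all add: radial_measure_def)

lemma nn_integral_radial_measure:
  assumes [measurable]: "G \<in> borel_measurable borel" "f \<in> borel_measurable borel"
  shows "(\<integral>\<^sup>+w. f w \<partial>radial_measure G) =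
    (\<integral>\<^sup>+w. indicator (ball 0 1) w * (ennreal (1 / pi) * G ((cmod w)\<^sup>2)) * f w \<partial>lborel)"
proof -
  have [measurable]: "ball (0::complex) 1 \<in> sets borel"
    by simp
  show ?thesis
    unfolding radial_measure_def by (rule nn_integral_density) measurable
qed

text \<open>The density sees \<open>w\<close> only through its modulus, so a rotation changes
  neither the density nor Lebesgue measure.\<close>

lemma distr_radial_measure_rotation:
  assumes [measurable]: "G \<in> borel_measurable borel" and c: "cmod c = 1" "Im c \<noteq> 0"
  shows "distr (radial_measure G) borel (\<lambda>w. c * w) = radial_measure G"
proof (rule measure_eqI)
  have [measurable]: "ball (0::complex) 1 \<in> sets borel"
    by simp
  fix A assume "A \<in> sets (distr (radial_measure G) borel (\<lambda>w. c * w))"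
  then have [measurable]: "A \<in> sets borel"
    by simp
  have "emeasure (distr (radial_measure G) borel (\<lambda>w. c * w)) A
      = (\<integral>\<^sup>+w. indicator A (c * w) \<partial>radial_measure G)"
    using nn_integral_distr[of "\<lambda>w. c * w" "radial_measure G" borel "indicator A"] by simp
  also have "\<dots> = (\<integral>\<^sup>+w. indicator (ball 0 1) (c * w) * (ennreal (1 / pi) * G ((cmod (c * w))\<^sup>2)) *
      indicator A (c * w) \<partial>lborel)"
    by (subst nn_integral_radial_measure) (auto simp: norm_mult c(1) indicator_def)
  also have "\<dots> = (\<integral>\<^sup>+w. indicator (ball 0 1) w * (ennreal (1 / pi) * G ((cmod w)\<^sup>2)) *
      indicator A w \<partial>lborel)"
    by (rule nn_integral_lborel_rotation[OF _ c]) measurable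
  also have "\<dots> = (\<integral>\<^sup>+w. indicator A w \<partial>radial_measure G)"
    by (subst nn_integral_radial_measure) auto
  also have "\<dots> = emeasure (radial_measure G) A"
    by simp
  finally show "emeasure (distr (radial_measure G) borel (\<lambda>w. c * w)) A =
      emeasure (radial_measure G) A" .
qed simp

text \<open>The disk of radius \<open>sqrt x\<close> has normalized area \<open>x\<close>, so the
  squared modulus is uniformly distributed. This is why the radial weight is a function of the
  squared modulus: no Jacobian factor appears. The comparison is made on the half-lines
  \<open>{x<..}\<close>.\<close>

lemma distr_radial_measure_norm_power2:
  "distr (radial_measure (\<lambda>_. 1)) borel (\<lambda>w. (cmod w)\<^sup>2) = density lborel (indicator {0<..<1})"
proof (rule measure_eqI_lessThan)
  let ?N = "distr (radial_measure (\<lambda>_. 1)) borel (\<lambda>w. (cmod w)\<^sup>2)"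
  have ball: "emeasure lborel (ball (0::complex) r) = ennreal (pi * r\<^sup>2)" if "r \<ge> 0" for r
    using emeasure_ball[OF that, of "0::complex"] by (simp add: unit_ball_vol_2)
  have cball: "emeasure lborel (cball (0::complex) r) = ennreal (pi * r\<^sup>2)" if "r \<ge> 0" for r
    using emeasure_cball[OF that, of "0::complex"] by (simp add: unit_ball_vol_2)
  have gt: "emeasure ?N {x<..} = ennreal (if x \<le> 0 then 1 else if x \<le> 1 then 1 - x else 0)" for x :: real
  proof -
    have "emeasure ?N {x<..} = emeasure (radial_measure (\<lambda>_. 1)) ((\<lambda>w. (cmod w)\<^sup>2) -` {x<..})"
      by (simp add: emeasure_distr)
    also have "\<dots> = (\<integral>\<^sup>+w. ennreal (1 / pi) * indicator (ball 0 1 \<inter> (\<lambda>w. (cmod w)\<^sup>2) -` {x<..}) w \<partial>lborel)"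
    proof (subst nn_integral_indicator[symmetric])
      have "(\<lambda>w. (cmod w)\<^sup>2) -` {x<..} \<inter> space (radial_measure (\<lambda>_. 1)) \<in> sets (radial_measure (\<lambda>_. 1))"
        by (rule measurable_sets[where A=borel]) auto
      then show *: "(\<lambda>w. (cmod w)\<^sup>2) -` {x<..} \<in> sets (radial_measure (\<lambda>_. 1))"
        by simp
      show "(\<integral>\<^sup>+w. indicator ((\<lambda>w. (cmod w)\<^sup>2) -` {x<..}) w \<partial>radial_measure (\<lambda>_. 1)) =
        (\<integral>\<^sup>+w. ennreal (1 / pi) * indicator (ball 0 1 \<inter> (\<lambda>w. (cmod w)\<^sup>2) -` {x<..}) w \<partial>lborel)"
        by (subst nn_integral_radial_measure)
          (use * in \<open>auto intro!: nn_integral_cong simp: indicator_def\<close>)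
    qed
    also have "\<dots> = ennreal (1 / pi) * emeasure lborel (ball 0 1 \<inter> (\<lambda>w. (cmod w)\<^sup>2) -` {x<..})"
    proof (rule nn_integral_cmult_indicator)
      have "(\<lambda>w. (cmod w)\<^sup>2) -` {x<..} \<inter> space borel \<in> sets borel"
        by (rule measurable_sets[where A=borel]) auto
      then show "ball 0 1 \<inter> (\<lambda>w. (cmod w)\<^sup>2) -` {x<..} \<in> sets lborel"
        by simp
    qed
    also have "emeasure lborel (ball 0 1 \<inter> (\<lambda>w::complex. (cmod w)\<^sup>2) -` {x<..}) =
      ennreal (if x < 0 then pi else if x \<le> 1 then pi * (1 - x) else 0)"
    proof -
      consider "x < 0" | "0 \<le> x" "x \<le> 1" | "x > 1"
        by linarith
      then show ?thesis
      proof cases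
        case 1
        then have "ball 0 1 \<inter> (\<lambda>w::complex. (cmod w)\<^sup>2) -` {x<..} = ball 0 1"
          by (auto intro: less_le_trans[OF _ zero_le_power2])
        with 1 ball[of 1] show ?thesis by simp
      next
        case 2
        have "cmod w \<le> sqrt x \<longleftrightarrow> (cmod w)\<^sup>2 \<le> x" for w
          using 2 by (metis norm_ge_zero real_le_rsqrt real_sqrt_ge_0_iff real_sqrt_pow2 power_mono)
        then have "ball 0 1 \<inter> (\<lambda>w::complex. (cmod w)\<^sup>2) -` {x<..} = ball 0 1 - cball 0 (sqrt x)"
          by (auto simp: not_le)
        moreover have "emeasure lborel (ball 0 1 - cball (0::complex) (sqrt x)) =
            ennreal pi - ennreal (pi * x)"
        \<comment> \<open>At \<open>x = 1\<close> the closed disk is not contained in the open one,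
          so the measure of the difference cannot be found by subtraction. The difference is empty
          there.\<close>
        proof (cases "x = 1")
          case False
          then have "sqrt x < 1"
            using 2 by simp
          then have "cball (0::complex) (sqrt x) \<subseteq> ball 0 1"
            by (simp add: cball_subset_ball_iff)
          then show ?thesis
            using 2 ball[of 1] cball[of "sqrt x"]
            by (subst emeasure_Diff) auto
        next
          case True
          have "ball 0 1 - cball (0::complex) 1 = {}"
            by auto
          then have "emeasure lborel (ball 0 1 - cball (0::complex) 1) = 0"
            by (metis emeasure_empty)
          with True show ?thesis
            by simp
        qed
        ultimately show ?thesis
          using 2 by (simp add: ennreal_minus algebra_simps)
      next
        case 3
        have "(cmod w)\<^sup>2 < 1" if "cmod w < 1" for w
          using that by (simp add: abs_square_less_1)
        then have "ball 0 1 \<inter> (\<lambda>w::complex. (cmod w)\<^sup>2) -` {x<..} = {}"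
          using 3 by fastforce
        with 3 show ?thesis by simp
      qed
    qed
    finally show ?thesis
      by (auto simp: ennreal_mult'[symmetric] field_simps)
  qed
  show "emeasure ?N {x<..} < \<infinity>" for x
    unfolding gt by simp
  show "emeasure ?N {x<..} = emeasure (density lborel (indicator {0<..<1})) {x<..}" for x
  proof -
    have "emeasure (density lborel (indicator {0<..<1})) {x<..} =
        emeasure lborel ({0<..<1} \<inter> {x<..})"
      by (subst emeasure_density) (auto simp: indicator_inter_arith[symmetric])
    also have "{0<..<1} \<inter> {x<..} = {max 0 x<..<1}"
      by auto
    also have "emeasure lborel \<dots> = ennreal (if x \<le> 0 then 1 else if x \<le> 1 then 1 - x else 0)"
      by (auto simp: max_def)
    finally show ?thesis
      unfolding gt ..
  qed
qed auto

lemma nn_integral_radial_measure_radial: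
  assumes [measurable]: "G \<in> borel_measurable borel" "g \<in> borel_measurable borel"
  shows "(\<integral>\<^sup>+w. g ((cmod w)\<^sup>2) \<partial>radial_measure G) =
    (\<integral>\<^sup>+t. indicator {0<..<1} t * (G t * g t) \<partial>lborel)"
proof -
  have "(\<integral>\<^sup>+w. g ((cmod w)\<^sup>2) \<partial>radial_measure G) =
      (\<integral>\<^sup>+w. G ((cmod w)\<^sup>2) * g ((cmod w)\<^sup>2) \<partial>radial_measure (\<lambda>_. 1))"
    by (simp add: nn_integral_radial_measure mult_ac)
  also have "\<dots> = (\<integral>\<^sup>+t. G t * g t \<partial>distr (radial_measure (\<lambda>_. 1)) borel (\<lambda>w. (cmod w)\<^sup>2))"
    by (subst nn_integral_distr) auto
  also have "\<dots> = (\<integral>\<^sup>+t. indicator {0<..<1} t * (G t * g t) \<partial>lborel)"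
    unfolding distr_radial_measure_norm_power2 by (subst nn_integral_density) auto
  finally show ?thesis .
qed

lemma AE_radial_measure:
  assumes [measurable]: "G \<in> borel_measurable borel"
  shows "AE w in radial_measure G. w \<in> ball 0 1"
proof -
  have [measurable]: "ball (0::complex) 1 \<in> sets borel"
    by simp
  show ?thesis
    unfolding radial_measure_def
    by (subst AE_density) (auto simp: indicator_def split: if_splits)
qed

text \<open>A rotation by \<open>c\<close> preserves the measure and multiplies the integrand by
  \<open>c ^ m * cnj c ^ n\<close>; if this factor is not 1, the integral must vanish. The argument
  also covers a non-integrable integrand, whose Bochner integral is 0.\<close>

lemma integral_radial_measure_orthogonal:
  assumes [measurable]: "G \<in> borel_measurable borel" and mn: "m \<noteq> n"
  shows "(\<integral>w. w ^ m * cnj w ^ n \<partial>radial_measure G) = 0"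
proof -
  have [measurable]: "cnj \<in> borel_measurable borel"
    by (intro borel_measurable_continuous_onI continuous_intros)
  \<comment> \<open>This angle makes the factor equal to the imaginary unit. As \<open>m\<close> and
    \<open>n\<close> differ by at least 1, the angle is nonzero and at most \<open>pi / 2\<close> in
    absolute value, so its sine does not vanish.\<close>
  define \<theta> where "\<theta> = pi / (2 * (real m - real n))"
  define c where "c = cis \<theta>"
  have "\<bar>real m - real n\<bar> \<ge> 1"
    using mn by linarith
  then have "\<bar>\<theta>\<bar> \<le> pi / 2"
    by (auto simp: \<theta>_def abs_mult divide_simps)
  moreover have "\<theta> \<noteq> 0"
    using mn by (simp add: \<theta>_def)
  ultimately have "sin \<theta> \<noteq> 0"
    using sin_gt_zero[of \<theta>] sin_gt_zero[of "- \<theta>"] pi_gt_zero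
    by (cases "\<theta> > 0") auto
  then have c: "cmod c = 1" "Im c \<noteq> 0"
    by (simp_all add: c_def)
  define r where "r = real m - real n"
  have "r \<noteq> 0"
    using mn by (simp add: r_def)
  have "real m * \<theta> - real n * \<theta> = r * \<theta>"
    by (simp add: r_def algebra_simps)
  also have "\<dots> = pi / 2"
    using \<open>r \<noteq> 0\<close> by (simp add: \<theta>_def flip: r_def)
  finally have "real m * \<theta> - real n * \<theta> = pi / 2" .
  then have i: "c ^ m * cnj c ^ n = \<i>"
    by (simp only: c_def Complex.DeMoivre cis_cnj cis_mult mult_minus_right flip: diff_conv_add_uminus) simp
  let ?I = "\<integral>w. w ^ m * cnj w ^ n \<partial>radial_measure G"
  have "?I = (\<integral>w. w ^ m * cnj w ^ n \<partial>distr (radial_measure G) borel (\<lambda>w. c * w))"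
    by (simp add: distr_radial_measure_rotation[OF _ c])
  also have "\<dots> = (\<integral>w. (c ^ m * cnj c ^ n) * (w ^ m * cnj w ^ n) \<partial>radial_measure G)"
    by (subst integral_distr) (auto simp: power_mult_distrib mult_ac)
  also have "\<dots> = \<i> * ?I"
    unfolding i by simp
  finally have "(1 - \<i>) * ?I = 0"
    by (simp add: algebra_simps)
  then show ?thesis
    by (metis complex_i_not_one eq_iff_diff_eq_0 mult_eq_0_iff)
qed

text \<open>On the disk the partial sums are bounded by the sum of the \<open>cmod (d n)\<close>,
  and the measure is finite, so dominated convergence reduces the claim to polynomials. There
  orthogonality leaves only the diagonal of the double sum.\<close>

lemma radial_measure_parseval:
  fixes d :: "nat \<Rightarrow> complex" and g :: "complex \<Rightarrow> complex"
  assumes G [measurable]: "G \<in> borel_measurable borel" and fin: "finite_measure (radial_measure G)"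
    and g [measurable]: "g \<in> borel_measurable borel"
    and d: "summable (\<lambda>n. cmod (d n))"
    and sums: "\<And>w. cmod w < 1 \<Longrightarrow> (\<lambda>n. d n * cnj w ^ n) sums g w"
  shows "integrable (radial_measure G) (\<lambda>w. (cmod (g w))\<^sup>2)"
    and "(\<lambda>n. (cmod (d n))\<^sup>2 * (\<integral>w. ((cmod w)\<^sup>2) ^ n \<partial>radial_measure G)) sums
           (\<integral>w. (cmod (g w))\<^sup>2 \<partial>radial_measure G)"
proof -
  interpret finite_measure "radial_measure G" by (rule fin)
  let ?\<mu> = "radial_measure G"
  have [measurable]: "cnj \<in> borel_measurable borel"
    by (intro borel_measurable_continuous_onI continuous_intros)
  define A where "A = (\<Sum>n. cmod (d n))"
  define S where "S = (\<lambda>N w. \<Sum>n<N. d n * cnj w ^ n)"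
  have S_meas [measurable]: "S N \<in> borel_measurable borel" for N
    unfolding S_def by measurable
  have bound: "cmod (S N w) \<le> A" if "cmod w < 1" for N w
  proof -
    have "cmod (S N w) \<le> (\<Sum>n<N. cmod (d n))"
      unfolding S_def
      by (intro sum_norm_le) (use that in \<open>auto simp: norm_mult norm_power intro!: mult_left_le power_le_one\<close>)
    also have "\<dots> \<le> A"
      unfolding A_def by (rule sum_le_suminf) (use d in auto)
    finally show ?thesis .
  qed
  have lim: "(\<lambda>N. S N w) \<longlonglongrightarrow> g w" if "cmod w < 1" for w
    using sums[OF that] by (simp add: sums_def S_def)
  have ae1: "AE w in ?\<mu>. (\<lambda>N. (cmod (S N w))\<^sup>2) \<longlonglongrightarrow> (cmod (g w))\<^sup>2"
    using AE_radial_measure[OF G] by eventually_elim (auto intro!: tendsto_intros lim)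
  have ae2: "AE w in ?\<mu>. norm ((cmod (S N w))\<^sup>2) \<le> A\<^sup>2" for N
    using AE_radial_measure[OF G] by eventually_elim (auto intro!: power_mono bound)
  have A: "integrable ?\<mu> (\<lambda>_. A\<^sup>2)"
    by simp
  show "integrable ?\<mu> (\<lambda>w. (cmod (g w))\<^sup>2)"
    by (rule integrable_dominated_convergence[OF _ _ A ae1 ae2]) measurable
  have conv: "(\<lambda>N. \<integral>w. (cmod (S N w))\<^sup>2 \<partial>?\<mu>) \<longlonglongrightarrow> (\<integral>w. (cmod (g w))\<^sup>2 \<partial>?\<mu>)"
    by (rule integral_dominated_convergence[OF _ _ A ae1 ae2]) measurable
  have int: "integrable ?\<mu> (\<lambda>w. w ^ m * cnj w ^ n)" for m n
  proof (rule integrable_const_bound[where B=1])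
    show "AE w in ?\<mu>. cmod (w ^ m * cnj w ^ n) \<le> 1"
      using AE_radial_measure[OF G]
      by eventually_elim (auto simp: norm_mult norm_power intro!: mult_le_one power_le_one)
  qed measurable
  have finite: "(\<integral>w. (cmod (S N w))\<^sup>2 \<partial>?\<mu>) =
      (\<Sum>n<N. (cmod (d n))\<^sup>2 * (\<integral>w. ((cmod w)\<^sup>2) ^ n \<partial>?\<mu>))" for N
  proof -
    have sq: "complex_of_real ((cmod (S N w))\<^sup>2) =
        (\<Sum>n<N. \<Sum>m<N. (d n * cnj (d m)) * (w ^ m * cnj w ^ n))" for w
    proof -
      have "complex_of_real ((cmod (S N w))\<^sup>2) = S N w * cnj (S N w)"
        by (rule complex_norm_square)
      also have "\<dots> = (\<Sum>n<N. \<Sum>m<N. (d n * cnj w ^ n) * cnj (d m * cnj w ^ m))"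
        unfolding S_def cnj_sum by (rule sum_product)
      finally show ?thesis
        by (simp add: mult_ac)
    qed
    have "complex_of_real (\<integral>w. (cmod (S N w))\<^sup>2 \<partial>?\<mu>) = (\<integral>w. complex_of_real ((cmod (S N w))\<^sup>2) \<partial>?\<mu>)"
      by (rule integral_complex_of_real[symmetric])
    also have "\<dots> = (\<Sum>n<N. \<Sum>m<N. (d n * cnj (d m)) * (\<integral>w. w ^ m * cnj w ^ n \<partial>?\<mu>))"
      unfolding sq by (simp add: int Bochner_Integration.integral_sum Bochner_Integration.integrable_sum)
    also have "\<dots> = (\<Sum>n<N. (d n * cnj (d n)) * (\<integral>w. w ^ n * cnj w ^ n \<partial>?\<mu>))"
    proof (rule sum.cong[OF refl])
      fix n assume "n \<in> {..<N}"
      have "(\<Sum>m<N. (d n * cnj (d m)) * (\<integral>w. w ^ m * cnj w ^ n \<partial>?\<mu>)) =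
          (\<Sum>m<N. if m = n then (d n * cnj (d n)) * (\<integral>w. w ^ n * cnj w ^ n \<partial>?\<mu>) else 0)"
        by (rule sum.cong) (auto simp: integral_radial_measure_orthogonal)
      also have "\<dots> = (d n * cnj (d n)) * (\<integral>w. w ^ n * cnj w ^ n \<partial>?\<mu>)"
        using \<open>n \<in> {..<N}\<close> by simp
      finally show "(\<Sum>m<N. (d n * cnj (d m)) * (\<integral>w. w ^ m * cnj w ^ n \<partial>?\<mu>)) = \<dots>" .
    qed
    also have "\<dots> = complex_of_real (\<Sum>n<N. (cmod (d n))\<^sup>2 * (\<integral>w. ((cmod w)\<^sup>2) ^ n \<partial>?\<mu>))"
    proof -
      have "(\<integral>w. w ^ n * cnj w ^ n \<partial>?\<mu>) = complex_of_real (\<integral>w. ((cmod w)\<^sup>2) ^ n \<partial>?\<mu>)" for n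
      proof -
        have "w ^ n * cnj w ^ n = complex_of_real (((cmod w)\<^sup>2) ^ n)" for w
          by (simp only: of_real_power[of "(cmod w)\<^sup>2"] complex_norm_square power_mult_distrib)
        then show ?thesis
          by (simp del: of_real_power)
      qed
      then show ?thesis
        by (simp only: of_real_sum of_real_mult complex_norm_square)
    qed
    finally show ?thesis
      using of_real_eq_iff by blast
  qed
  show "(\<lambda>n. (cmod (d n))\<^sup>2 * (\<integral>w. ((cmod w)\<^sup>2) ^ n \<partial>?\<mu>)) sums (\<integral>w. (cmod (g w))\<^sup>2 \<partial>?\<mu>)"
    using conv unfolding finite sums_def .
qed

subsection \<open>Binomial coefficients and Gamma quotients\<close>

text \<open>In the binomial series with exponent \<open>- a\<close> at \<open>- z\<close>, the sign
  of the binomial coefficient cancels the sign of the power, which leaves coefficients that are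
  nonnegative for positive \<open>a\<close>.\<close>

lemma neg_binomial_complex:
  fixes z :: complex and a :: real
  assumes "cmod z < 1"
  shows "(\<lambda>n. of_real (pochhammer a n / fact n) * z ^ n) sums (1 - z) powr (- of_real a)"
proof -
  have "((- complex_of_real a) gchoose n) * (- z) ^ n = of_real (pochhammer a n / fact n) * z ^ n" for n
  proof -
    have "((- complex_of_real a) gchoose n) * (- z) ^ n =
        ((-1) ^ n * (-1) ^ n) * (of_real (pochhammer a n / fact n) * z ^ n)"
      by (simp only: gbinomial_pochhammer power_minus[of z] minus_minus)
        (simp add: pochhammer_of_real)
    also have "(-1) ^ n * (-1) ^ n = (1 :: complex)"
      by (simp flip: power_mult_distrib)
    finally show ?thesis
      by simp
  qed
  then show ?thesis
    using gen_binomial_complex[of "- z" "- of_real a"] assms by simp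
qed

lemma neg_binomial_real:
  fixes x a :: real
  assumes "\<bar>x\<bar> < 1"
  shows "(\<lambda>n. pochhammer a n / fact n * x ^ n) sums (1 - x) powr (- a)"
proof -
  have "((- a) gchoose n) * (- x) ^ n = pochhammer a n / fact n * x ^ n" for n
  proof -
    have "((- a) gchoose n) * (- x) ^ n = ((-1) ^ n * (-1) ^ n) * (pochhammer a n / fact n * x ^ n)"
      by (simp only: gbinomial_pochhammer power_minus[of x] minus_minus) simp
    also have "(-1) ^ n * (-1) ^ n = (1 :: real)"
      by (simp flip: power_mult_distrib)
    finally show ?thesis
      by simp
  qed
  then show ?thesis
    using gen_binomial_real[of "- x" "- a"] assms by simp
qed

lemma nn_integral_power_times_powr:
  assumes "b > 0"
  shows "(\<integral>\<^sup>+t. indicator {0<..<1} t * ennreal (t ^ n * (1 - t) powr (b - 1)) \<partial>lborel) =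
    ennreal (Beta (real n + 1) b)"
proof -
  \<comment> \<open>On the open interval \<open>t\<close> is positive, where \<open>powr\<close>
    with a natural exponent is the ordinary power. At 0 the two differ for exponent 0.\<close>
  have "((\<lambda>t. t powr (real n + 1 - 1) * (1 - t) powr (b - 1)) has_integral Beta (real n + 1) b) {0<..<1}"
    using has_integral_Beta_real[of "real n + 1" b] assms by (simp add: has_integral_Icc_iff_Ioo)
  then have "((\<lambda>t. t ^ n * (1 - t) powr (b - 1)) has_integral Beta (real n + 1) b) {0<..<1}"
    by (rule has_integral_eq[rotated]) (auto simp: powr_realpow)
  from nn_integral_has_integral_lebesgue[OF _ this]
  have "integral\<^sup>N lborel (\<lambda>t. ennreal (indicator {0<..<1} t * (t ^ n * (1 - t) powr (b - 1)))) =
      ennreal (Beta (real n + 1) b)"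
    by auto
  then show ?thesis
    by (simp add: ennreal_mult' ennreal_indicator)
qed

section \<open>The Gamma quotient comparing the two coefficient sequences\<close>

definition gamma_ratio :: "real \<Rightarrow> real \<Rightarrow> nat \<Rightarrow> real" where
  "gamma_ratio a s n = (Gamma (a + n))\<^sup>2 / (Gamma (2 * a - s + n) * Gamma (s + n))"

lemma gamma_ratio_pos:
  assumes "0 < s" "s < 2 * a"
  shows "gamma_ratio a s n > 0"
  using assms by (auto simp: gamma_ratio_def intro!: divide_pos_pos mult_pos_pos zero_less_power)

text \<open>The two arguments in the denominator have the same sum as those in the numerator, hence a
  smaller product, and the powers of \<open>n\<close> in the asymptotics cancel.\<close>

lemma incseq_gamma_ratio:
  assumes s: "0 < s" "s < 2 * a"
  shows "incseq (gamma_ratio a s)"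
proof (rule incseq_SucI)
  fix n :: nat
  define u v w where "u = a + n" and "v = 2 * a - s + n" and "w = s + n"
  have pos: "u > 0" "v > 0" "w > 0"
    using s by (auto simp: u_def v_def w_def)
  have "u\<^sup>2 - v * w = (a - s)\<^sup>2"
    by (simp add: u_def v_def w_def power2_eq_square algebra_simps)
  then have le: "v * w \<le> u\<^sup>2"
    using zero_le_power2[of "a - s"] by linarith
  have G: "Gamma (x + 1) = x * Gamma x" if "x > 0" for x :: real
    using that by (intro Gamma_plus1) auto
  have "gamma_ratio a s (Suc n) = (Gamma (u + 1))\<^sup>2 / (Gamma (v + 1) * Gamma (w + 1))"
    by (simp add: gamma_ratio_def u_def v_def w_def add_ac)
  also have "\<dots> = u\<^sup>2 / (v * w) * gamma_ratio a s n"
    using pos by (simp add: G gamma_ratio_def u_def v_def w_def power_mult_distrib)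
  also have "\<dots> \<ge> 1 * gamma_ratio a s n"
    using le pos gamma_ratio_pos[OF s, of n] by (intro mult_right_mono) auto
  finally show "gamma_ratio a s n \<le> gamma_ratio a s (Suc n)"
    by simp
qed

lemma gamma_ratio_tendsto_1:
  assumes s: "0 < s" "s < 2 * a"
  shows "gamma_ratio a s \<longlonglongrightarrow> 1"
proof -
  \<comment> \<open>\<open>C\<close> is the ratio at index 0. It converts the quotient of Pochhammer
    symbols, which comes from the approximants \<open>Gamma_series'\<close>, into a quotient of
    Gamma values, and it is the reciprocal of their limit.\<close>
  define C where "C = (Gamma a)\<^sup>2 / (Gamma (2 * a - s) * Gamma s)"
  have np: "x \<notin> \<int>\<^sub>\<le>\<^sub>0" if "x > 0" for x :: real
    using that by auto
  have ps: "Gamma a > 0" "Gamma (2 * a - s) > 0" "Gamma s > 0"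
    using s by auto
  have "(\<lambda>n. C * (Gamma_series' (2 * a - s) n * Gamma_series' s n / (Gamma_series' a n)\<^sup>2)) \<longlonglongrightarrow>
      C * (Gamma (2 * a - s) * Gamma s / (Gamma a)\<^sup>2)"
    using ps by (intro tendsto_intros Gamma_series'_LIMSEQ) auto
  moreover have "C * (Gamma (2 * a - s) * Gamma s / (Gamma a)\<^sup>2) = 1"
    using ps by (simp add: C_def)
  moreover have "C * (Gamma_series' (2 * a - s) n * Gamma_series' s n / (Gamma_series' a n)\<^sup>2) =
      gamma_ratio a s n" for n
  proof -
    have P: "Gamma (x + n) = pochhammer x n * Gamma x" if "x > 0" for x :: real
      using pochhammer_Gamma[OF np[OF that], of n] Gamma_real_pos[OF that] by (simp add: field_simps)
    have e: "exp ((2 * a - s) * ln n) * exp (s * ln n) = (exp (a * ln n))\<^sup>2"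
      by (simp add: power2_eq_square flip: exp_add) (simp add: algebra_simps)
    have "Gamma_series' (2 * a - s) n * Gamma_series' s n / (Gamma_series' a n)\<^sup>2 =
       (fact (n - 1))\<^sup>2 * (exp ((2 * a - s) * ln n) * exp (s * ln n)) /
          (pochhammer (2 * a - s) n * pochhammer s n) /
       ((fact (n - 1))\<^sup>2 * (exp (a * ln n))\<^sup>2 / (pochhammer a n)\<^sup>2)"
      by (simp add: Gamma_series'_def power_mult_distrib power_divide power2_eq_square)
    also have "\<dots> = (pochhammer a n)\<^sup>2 / (pochhammer (2 * a - s) n * pochhammer s n)"
      unfolding e by simp
    finally show ?thesis
      using s by (simp add: gamma_ratio_def C_def P power_mult_distrib mult_ac)
  qed
  ultimately show ?thesis
    by (simp only:)
qed

lemma gamma_ratio_le_1: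
  assumes "0 < s" "s < 2 * a"
  shows "gamma_ratio a s n \<le> 1"
  using incseq_le[OF incseq_gamma_ratio gamma_ratio_tendsto_1] assms by blast

text \<open>At \<open>s = (1 + \<alpha>) / p\<close> this is the claimed norm, since then
  \<open>1 + \<alpha> - s\<close> is \<open>(1 + \<alpha>) / q\<close>. For general \<open>s\<close>
  it is the limit of the coefficient quotients.\<close>

definition schur_const :: "real \<Rightarrow> real \<Rightarrow> real" where
  "schur_const \<alpha> s = (1 + \<alpha>) * Gamma s * Gamma (1 + \<alpha> - s) / (Gamma ((2 + \<alpha>) / 2))\<^sup>2"

lemma schur_const_pos:
  assumes "0 < s" "s < 1 + \<alpha>"
  shows "schur_const \<alpha> s > 0"
  using assms unfolding schur_const_def
  by (intro divide_pos_pos mult_pos_pos zero_less_power Gamma_real_pos) auto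

text \<open>On the left stands the squared binomial coefficient of the expanded kernel times the
  moment of order \<open>n\<close> of the weighted measure. The factor \<open>Gamma (n + 1)\<close>
  in the Beta function cancels one of the two factorials.\<close>

lemma kernel_coeff_eq:
  assumes s: "0 < s" "s < 1 + \<alpha>" and a: "a = (2 + \<alpha>) / 2"
  shows "(pochhammer a n / fact n)\<^sup>2 * ((1 + \<alpha>) * Beta (real n + 1) (1 + \<alpha> - s)) =
    schur_const \<alpha> s * gamma_ratio a s n * (pochhammer s n / fact n)"
proof -
  have np: "x \<notin> \<int>\<^sub>\<le>\<^sub>0" if "x > 0" for x :: real
    using that by auto
  have P: "pochhammer x n = Gamma (x + n) / Gamma x" if "x > 0" for x :: real
    using pochhammer_Gamma[OF np[OF that], of n] .
  have f: "Gamma (real n + 1) = fact n"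
    using Gamma_fact[of n, where 'a=real] by (simp add: add_ac)
  have e: "real n + 1 + (1 + \<alpha> - s) = 2 * a - s + n"
    by (simp add: a field_simps)
  have "2 * a - s > 0" "a > 0"
    using s by (auto simp: a field_simps)
  then have pos: "Gamma (s + n) > 0" "Gamma s > 0" "Gamma a > 0" "Gamma (2 * a - s + n) > 0"
    using s by (auto intro!: Gamma_real_pos)
  \<comment> \<open>Pure algebra with the Gamma values as variables: \<open>A\<close>,
    \<open>B\<close>, \<open>D\<close>, \<open>E\<close>, \<open>S\<close>, \<open>T\<close> are
    Gamma at \<open>a + n\<close>, \<open>a\<close>, \<open>1 + \<alpha> - s\<close>,
    \<open>2 * a - s + n\<close>, \<open>s\<close>, \<open>s + n\<close>; \<open>F\<close> is the
    factorial and \<open>k\<close> is \<open>1 + \<alpha>\<close>.\<close>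
  have alg: "(A / B / F)\<^sup>2 * (k * (F * D / E)) = k * S * D / B\<^sup>2 * (A\<^sup>2 / (E * T)) * (T / S / F)"
    if "F > 0" "S > 0" "T > 0" for A B D E F S T k :: real
    using that by (simp add: power2_eq_square) (simp add: mult_ac)
  show ?thesis
    unfolding Beta_def e f gamma_ratio_def schur_const_def a[symmetric] P[OF s(1)] P[OF \<open>a > 0\<close>]
    by (rule alg) (use pos in auto)
qed

subsection \<open>Integrals of the kernel against radial powers\<close>

lemma sets_weighted_disk_area [measurable_cong, simp]:
    "sets (weighted_disk_area \<alpha>) = sets (lebesgue_on (ball 0 1))"
  and space_weighted_disk_area [simp]: "space (weighted_disk_area \<alpha>) = ball 0 1"
  by (simp_all add: weighted_disk_area_def disk_area_def)

lemma borel_measurable_weighted_disk_area [simp]: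
  "borel_measurable (weighted_disk_area \<alpha>) = borel_measurable (lebesgue_on (ball 0 1))"
  by (rule measurable_cong_sets) simp_all

lemma borel_measurable_imp_lebesgue_on:
  "f \<in> borel_measurable borel \<Longrightarrow> f \<in> borel_measurable (lebesgue_on S)"
  by (intro measurable_restrict_space1 measurable_completion) simp

text \<open>The densities become factors, the restriction to the disk becomes an indicator, and
  completing the measure does not change nonnegative integrals. This connects the Lebesgue setting
  of the definitions with the Borel measures used for rotations.\<close>

lemma nn_integral_weighted_disk_area_lborel:
  assumes f [measurable]: "f \<in> borel_measurable (lebesgue_on (ball 0 1))"
  shows "(\<integral>\<^sup>+w. f w \<partial>weighted_disk_area \<alpha>) =
    (\<integral>\<^sup>+w. indicator (ball 0 1) w *
      (ennreal (1 / pi) * ennreal ((1 + \<alpha>) * (1 - (cmod w)\<^sup>2) powr \<alpha>)) * f w \<partial>lborel)"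
proof -
  let ?h = "\<lambda>w. ennreal ((1 + \<alpha>) * (1 - (cmod w)\<^sup>2) powr \<alpha>)"
  have [measurable]: "?h \<in> borel_measurable (lebesgue_on (ball 0 1))"
    by (intro borel_measurable_imp_lebesgue_on) measurable
  have "(\<integral>\<^sup>+w. f w \<partial>weighted_disk_area \<alpha>) = (\<integral>\<^sup>+w. ?h w * f w \<partial>disk_area)"
    unfolding weighted_disk_area_def
    by (rule nn_integral_density) (simp_all add: disk_area_def)
  also have "\<dots> = (\<integral>\<^sup>+w. ennreal (1 / pi) * (?h w * f w) \<partial>lebesgue_on (ball 0 1))"
    unfolding disk_area_def by (rule nn_integral_density) simp_all
  also have "\<dots> = (\<integral>\<^sup>+w. ennreal (1 / pi) * (?h w * f w) * indicator (ball 0 1) w \<partial>lebesgue)"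
    by (rule nn_integral_restrict_space) simp
  finally show ?thesis
    by (simp add: nn_integral_completion mult_ac)
qed

lemma nn_integral_weighted_disk_area:
  assumes "f \<in> borel_measurable borel"
  shows "(\<integral>\<^sup>+w. f w \<partial>weighted_disk_area \<alpha>) =
    (\<integral>\<^sup>+w. f w \<partial>radial_measure (\<lambda>t. ennreal ((1 + \<alpha>) * (1 - t) powr \<alpha>)))"
  using assms
  by (simp add: nn_integral_weighted_disk_area_lborel borel_measurable_imp_lebesgue_on
      nn_integral_radial_measure)

text \<open>The radial power is absorbed into the density, whose exponent drops from \<alpha> to
  \<alpha> - s. The Parseval identity then applies to a single radial measure.\<close>

lemma nn_integral_weighted_disk_area_powr:
  assumes \<alpha>: "\<alpha> > -1" and f [measurable]: "f \<in> borel_measurable borel"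
  shows "(\<integral>\<^sup>+w. f w * ennreal ((1 - (cmod w)\<^sup>2) powr (- s)) \<partial>weighted_disk_area \<alpha>) =
    (\<integral>\<^sup>+w. f w \<partial>radial_measure (\<lambda>t. ennreal ((1 + \<alpha>) * (1 - t) powr (\<alpha> - s))))"
  (is "?L = ?R")
proof -
  have "?L = (\<integral>\<^sup>+w. f w * ennreal ((1 - (cmod w)\<^sup>2) powr (- s))
      \<partial>radial_measure (\<lambda>t. ennreal ((1 + \<alpha>) * (1 - t) powr \<alpha>)))"
    by (rule nn_integral_weighted_disk_area) measurable
  also have "\<dots> = ?R"
    using \<alpha>
    by (auto simp: nn_integral_radial_measure powr_diff powr_minus divide_inverse ennreal_mult' mult_ac
        intro!: nn_integral_cong)
  finally show ?thesis .
qed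

text \<open>In the variable \<open>t\<close>, the squared modulus, this is a Beta integral;
  \<open>s < 1 + \<alpha>\<close> is its convergence condition at \<open>t = 1\<close>.\<close>

lemma nn_integral_power_radial_powr:
  assumes \<alpha>: "\<alpha> > -1" and s: "s < 1 + \<alpha>"
  shows "(\<integral>\<^sup>+w. ennreal (((cmod w)\<^sup>2) ^ n)
      \<partial>radial_measure (\<lambda>t. ennreal ((1 + \<alpha>) * (1 - t) powr (\<alpha> - s)))) =
    ennreal ((1 + \<alpha>) * Beta (real n + 1) (1 + \<alpha> - s))"
  (is "?L = _")
proof -
  have "?L = (\<integral>\<^sup>+t. indicator {0<..<1} t *
      (ennreal ((1 + \<alpha>) * (1 - t) powr (\<alpha> - s)) * ennreal (t ^ n)) \<partial>lborel)"
    by (rule nn_integral_radial_measure_radial) measurable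
  also have "\<dots> = (\<integral>\<^sup>+t. ennreal (1 + \<alpha>) * (indicator {0<..<1} t *
      ennreal (t ^ n * (1 - t) powr (1 + \<alpha> - s - 1))) \<partial>lborel)"
    using \<alpha> by (intro nn_integral_cong) (auto simp: indicator_def ennreal_mult' mult_ac)
  also have "\<dots> = ennreal (1 + \<alpha>) * ennreal (Beta (real n + 1) (1 + \<alpha> - s))"
    using nn_integral_power_times_powr[of "1 + \<alpha> - s" n] s by (subst nn_integral_cmult) auto
  finally show ?thesis
    using \<alpha> by (simp add: ennreal_mult')
qed

text \<open>This is the zeroth moment, with \<open>Beta 1 b = 1 / b\<close>. It gives the total mass
  at \<open>s = 0\<close> and later the norms of the test functions.\<close>

lemma nn_integral_weighted_disk_area_powr_const:
  assumes \<alpha>: "\<alpha> > -1" and s: "s < 1 + \<alpha>"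
  shows "(\<integral>\<^sup>+w. ennreal ((1 - (cmod w)\<^sup>2) powr (- s)) \<partial>weighted_disk_area \<alpha>) =
    ennreal ((1 + \<alpha>) / (1 + \<alpha> - s))"
proof -
  have pos: "1 + \<alpha> - s > 0"
    using s by simp
  have "Beta 1 b = 1 / b" if "b > 0" for b :: real
  proof -
    have "b \<notin> \<int>\<^sub>\<le>\<^sub>0"
      using that by auto
    then show ?thesis
      using Gamma_plus1[of b] Gamma_real_pos[OF that] by (simp add: Beta_def add.commute)
  qed
  from this[OF pos] have Beta: "(1 + \<alpha>) * Beta (real 0 + 1) (1 + \<alpha> - s) = (1 + \<alpha>) / (1 + \<alpha> - s)"
    by (simp only: of_nat_0 add_0) simp
  show ?thesis
    using nn_integral_weighted_disk_area_powr[OF \<alpha>, of "\<lambda>_. 1" s]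
      nn_integral_power_radial_powr[OF \<alpha> s, of 0, unfolded Beta]
    by (simp only: mult_1 power_0 ennreal_1 borel_measurable_const)
qed

lemma emeasure_weighted_disk_area_space:
  assumes "\<alpha> > -1"
  shows "emeasure (weighted_disk_area \<alpha>) (space (weighted_disk_area \<alpha>)) = 1"
proof -
  have "emeasure (weighted_disk_area \<alpha>) (space (weighted_disk_area \<alpha>)) =
      (\<integral>\<^sup>+w. 1 \<partial>weighted_disk_area \<alpha>)"
    by simp
  \<comment> \<open>\<open>powr\<close> with exponent 0 is 1 only for a nonzero base, which the open
    disk guarantees.\<close>
  also have "\<dots> = (\<integral>\<^sup>+w. ennreal ((1 - (cmod w)\<^sup>2) powr (- 0)) \<partial>weighted_disk_area \<alpha>)"
    by (rule nn_integral_cong) (auto simp: power_eq_1_iff abs_square_eq_1)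
  also have "\<dots> = 1"
    using assms by (subst nn_integral_weighted_disk_area_powr_const) auto
  finally show ?thesis .
qed

lemma finite_measure_weighted_disk_area:
  "\<alpha> > -1 \<Longrightarrow> finite_measure (weighted_disk_area \<alpha>)"
  by (rule finite_measureI) (simp only: emeasure_weighted_disk_area_space, simp)

section \<open>The kernel integral as a power series\<close>

definition bergman_kernel :: "real \<Rightarrow> complex \<Rightarrow> complex \<Rightarrow> real" where
  "bergman_kernel \<alpha> z w = 1 / cmod (1 - z * cnj w) powr (2 + \<alpha>)"

lemma bergman_kernel_nonneg [simp]: "bergman_kernel \<alpha> z w \<ge> 0"
  by (simp add: bergman_kernel_def)

text \<open>The two bases are complex conjugates. By this symmetry one integral estimate serves both
  conditions of Schur's test.\<close>

lemma bergman_kernel_commute: "bergman_kernel \<alpha> z w = bergman_kernel \<alpha> w z"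
proof -
  have "cmod (1 - z * cnj w) = cmod (cnj (1 - z * cnj w))"
    by (rule complex_mod_cnj[symmetric])
  then show ?thesis
    by (simp add: bergman_kernel_def mult.commute)
qed

lemma measurable_bergman_kernel [measurable (raw)]:
  assumes [measurable]: "f \<in> borel_measurable M" "g \<in> borel_measurable M"
  shows "(\<lambda>x. bergman_kernel \<alpha> (f x) (g x)) \<in> borel_measurable M"
proof -
  have [measurable]: "cnj \<in> borel_measurable borel"
    by (intro borel_measurable_continuous_onI continuous_intros)
  show ?thesis
    unfolding bergman_kernel_def by measurable
qed

text \<open>The kernel is \<open>\<bar>(1 - z w\<^sup>*)\<^bsup>-a\<^esup>\<bar>\<^sup>2\<close> with \<open>a = (2 + \<alpha>) / 2\<close>; expand the power binomially
  and use that distinct powers of \<open>w\<^sup>*\<close> are orthogonal for radial weights.\<close>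

lemma bergman_kernel_integral_sums:
  assumes \<alpha>: "\<alpha> > -1" and s: "0 < s" "s < 1 + \<alpha>" and z: "cmod z < 1" and a: "a = (2 + \<alpha>) / 2"
  obtains I where "I \<ge> 0"
    "(\<integral>\<^sup>+w. ennreal (bergman_kernel \<alpha> z w) * ennreal ((1 - (cmod w)\<^sup>2) powr (- s))
        \<partial>weighted_disk_area \<alpha>) = ennreal I"
    "(\<lambda>n. schur_const \<alpha> s * gamma_ratio a s n * (pochhammer s n / fact n) * ((cmod z)\<^sup>2) ^ n) sums I"
proof -
  define G where "G = (\<lambda>t. ennreal ((1 + \<alpha>) * (1 - t) powr (\<alpha> - s)))"
  define d where "d = (\<lambda>n. complex_of_real (pochhammer a n / fact n) * z ^ n)"
  \<comment> \<open>Defining \<open>g\<close> by the series rather than by the complex power makes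
    its Borel measurability on the whole plane immediate; on the disk the two agree.\<close>
  define g where "g = (\<lambda>w. \<Sum>n. d n * cnj w ^ n)"
  have [measurable]: "cnj \<in> borel_measurable borel"
    by (intro borel_measurable_continuous_onI continuous_intros)
  have G [measurable]: "G \<in> borel_measurable borel"
    unfolding G_def by measurable
  have g_meas [measurable]: "g \<in> borel_measurable borel"
    unfolding g_def by measurable
  have ap: "a > 0"
    using \<alpha> by (simp add: a)
  have J: "(\<integral>\<^sup>+w. ennreal (((cmod w)\<^sup>2) ^ n) \<partial>radial_measure G) =
      ennreal ((1 + \<alpha>) * Beta (real n + 1) (1 + \<alpha> - s))" for n
    unfolding G_def by (rule nn_integral_power_radial_powr[OF \<alpha> s(2)])
  have fin: "finite_measure (radial_measure G)"
  proof (rule finite_measureI)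
    show "emeasure (radial_measure G) (space (radial_measure G)) \<noteq> \<infinity>"
      using J[of 0] by simp
  qed
  have B: "(1 + \<alpha>) * Beta (real n + 1) (1 + \<alpha> - s) \<ge> 0" for n
    using \<alpha> s by (auto simp: Beta_def intro!: mult_nonneg_nonneg divide_nonneg_nonneg Gamma_real_nonneg)
  have J': "(\<integral>w. ((cmod w)\<^sup>2) ^ n \<partial>radial_measure G) = (1 + \<alpha>) * Beta (real n + 1) (1 + \<alpha> - s)" for n
    using J[of n] B[of n] by (subst integral_eq_nn_integral) auto
  have d: "summable (\<lambda>n. cmod (d n))"
    using neg_binomial_real[of "cmod z" a] z ap
    by (auto simp: d_def norm_mult norm_power abs_mult pochhammer_nonneg norm_divide dest!: sums_summable)
  have powr: "(\<lambda>n. d n * cnj w ^ n) sums (1 - z * cnj w) powr (- of_real a)" if "cmod w < 1" for w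
  proof -
    have "cmod (z * cnj w) < 1"
      using z that by (simp add: norm_mult) (metis mult_strict_mono' mult_1 norm_ge_zero)
    from neg_binomial_complex[OF this, of a] show ?thesis
      by (simp add: d_def power_mult_distrib mult_ac)
  qed
  then have sums: "(\<lambda>n. d n * cnj w ^ n) sums g w" if "cmod w < 1" for w
    unfolding g_def using that by (metis sums_unique)
  have gK: "(cmod (g w))\<^sup>2 = bergman_kernel \<alpha> z w" if "cmod w < 1" for w
  proof -
    have "g w = (1 - z * cnj w) powr (- of_real a)"
      using powr[OF that] sums[OF that] sums_unique2 by blast
    \<comment> \<open>For a real exponent the modulus of the complex power is the power of the
      modulus. Squaring doubles the exponent to \<open>- (2 + \<alpha>)\<close>.\<close>
    then have "cmod (g w) = cmod (1 - z * cnj w) powr (- a)"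
      by (simp add: norm_powr_real_powr')
    then have "(cmod (g w))\<^sup>2 = cmod (1 - z * cnj w) powr (- a + - a)"
      by (simp only: power2_eq_square powr_add)
    moreover have "- a + - a = - (2 + \<alpha>)"
      by (simp add: a)
    ultimately show ?thesis
      by (simp only: bergman_kernel_def powr_minus_divide)
  qed
  define I where "I = (\<integral>w. (cmod (g w))\<^sup>2 \<partial>radial_measure G)"
  note parseval = radial_measure_parseval[OF G fin g_meas d sums]
  show ?thesis
  proof (rule that)
    show "I \<ge> 0"
      unfolding I_def by simp
    have "(\<integral>\<^sup>+w. ennreal (bergman_kernel \<alpha> z w) * ennreal ((1 - (cmod w)\<^sup>2) powr (- s))
        \<partial>weighted_disk_area \<alpha>) = (\<integral>\<^sup>+w. ennreal (bergman_kernel \<alpha> z w) \<partial>radial_measure G)"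
      unfolding G_def by (rule nn_integral_weighted_disk_area_powr[OF \<alpha>]) measurable
    also have "\<dots> = (\<integral>\<^sup>+w. ennreal ((cmod (g w))\<^sup>2) \<partial>radial_measure G)"
      using AE_radial_measure[OF G]
      by (intro nn_integral_cong_AE) (auto simp: gK elim!: eventually_mono)
    also have "\<dots> = ennreal I"
      unfolding I_def by (rule nn_integral_eq_integral[OF parseval(1)]) auto
    finally show "(\<integral>\<^sup>+w. ennreal (bergman_kernel \<alpha> z w) * ennreal ((1 - (cmod w)\<^sup>2) powr (- s))
        \<partial>weighted_disk_area \<alpha>) = ennreal I" .
    have "(cmod (d n))\<^sup>2 * (\<integral>w. ((cmod w)\<^sup>2) ^ n \<partial>radial_measure G) =
        schur_const \<alpha> s * gamma_ratio a s n * (pochhammer s n / fact n) * ((cmod z)\<^sup>2) ^ n" for n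
    proof -
      have "(cmod (d n))\<^sup>2 = (pochhammer a n / fact n)\<^sup>2 * ((cmod z)\<^sup>2) ^ n"
        by (simp add: d_def norm_mult norm_power norm_divide power_mult_distrib power_divide
            power_mult[symmetric] mult.commute)
      then have "(cmod (d n))\<^sup>2 * (\<integral>w. ((cmod w)\<^sup>2) ^ n \<partial>radial_measure G) =
          (pochhammer a n / fact n)\<^sup>2 * ((1 + \<alpha>) * Beta (real n + 1) (1 + \<alpha> - s)) * ((cmod z)\<^sup>2) ^ n"
        unfolding J' by (simp only: mult_ac)
      then show ?thesis
        unfolding kernel_coeff_eq[OF s a] .
    qed
    then show "(\<lambda>n. schur_const \<alpha> s * gamma_ratio a s n * (pochhammer s n / fact n) * ((cmod z)\<^sup>2) ^ n)
        sums I"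
      using parseval(2) unfolding I_def by simp
  qed
qed

text \<open>The Gamma ratios are at most 1 and all other factors are nonnegative, so the series is
  dominated term by term by a multiple of the binomial series.\<close>

lemma bergman_kernel_integral_le:
  assumes \<alpha>: "\<alpha> > -1" and s: "0 < s" "s < 1 + \<alpha>" and z: "cmod z < 1"
  shows "(\<integral>\<^sup>+w. ennreal (bergman_kernel \<alpha> z w) * ennreal ((1 - (cmod w)\<^sup>2) powr (- s))
      \<partial>weighted_disk_area \<alpha>) \<le> ennreal (schur_const \<alpha> s * (1 - (cmod z)\<^sup>2) powr (- s))"
proof -
  define a where "a = (2 + \<alpha>) / 2"
  obtain I where I: "I \<ge> 0"
    "(\<integral>\<^sup>+w. ennreal (bergman_kernel \<alpha> z w) * ennreal ((1 - (cmod w)\<^sup>2) powr (- s))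
        \<partial>weighted_disk_area \<alpha>) = ennreal I"
    "(\<lambda>n. schur_const \<alpha> s * gamma_ratio a s n * (pochhammer s n / fact n) * ((cmod z)\<^sup>2) ^ n) sums I"
    using bergman_kernel_integral_sums[OF \<alpha> s z a_def] by blast
  have s2: "s < 2 * a"
    using s by (simp add: a_def)
  have "\<bar>(cmod z)\<^sup>2\<bar> < 1"
    using z by (simp add: abs_square_less_1)
  from sums_mult[OF neg_binomial_real[OF this], of "schur_const \<alpha> s" s]
  have "(\<lambda>n. schur_const \<alpha> s * (pochhammer s n / fact n * ((cmod z)\<^sup>2) ^ n)) sums
      (schur_const \<alpha> s * (1 - (cmod z)\<^sup>2) powr (- s))" .
  with I(3) have "I \<le> schur_const \<alpha> s * (1 - (cmod z)\<^sup>2) powr (- s)"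
  proof (rule sums_le[rotated])
    fix n
    have "gamma_ratio a s n * (schur_const \<alpha> s * (pochhammer s n / fact n * ((cmod z)\<^sup>2) ^ n)) \<le>
        1 * (schur_const \<alpha> s * (pochhammer s n / fact n * ((cmod z)\<^sup>2) ^ n))"
      using gamma_ratio_le_1[OF s(1) s2] less_imp_le[OF schur_const_pos[OF s]] s(1)
      by (intro mult_right_mono mult_nonneg_nonneg divide_nonneg_nonneg)
        (auto simp: pochhammer_nonneg)
    then show "schur_const \<alpha> s * gamma_ratio a s n * (pochhammer s n / fact n) * ((cmod z)\<^sup>2) ^ n \<le>
        schur_const \<alpha> s * (pochhammer s n / fact n * ((cmod z)\<^sup>2) ^ n)"
      by (simp add: mult_ac)
  qed
  then show ?thesis
    unfolding I(2) by (rule ennreal_leI)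
qed

text \<open>The lower bound for the ratio at a single index \<open>N\<close> controls all later terms, as the ratio
  increases.\<close>

lemma bergman_kernel_integral_ge:
  assumes \<alpha>: "\<alpha> > -1" and s: "0 < s" "s < 1 + \<alpha>" and z: "cmod z < 1"
  shows "(\<integral>\<^sup>+w. ennreal (bergman_kernel \<alpha> z w) * ennreal ((1 - (cmod w)\<^sup>2) powr (- s))
      \<partial>weighted_disk_area \<alpha>) \<ge>
    ennreal (schur_const \<alpha> s * gamma_ratio ((2 + \<alpha>) / 2) s N *
      ((1 - (cmod z)\<^sup>2) powr (- s) - (\<Sum>n<N. pochhammer s n / fact n)))"
proof -
  define a where "a = (2 + \<alpha>) / 2"
  obtain I where I: "I \<ge> 0"
    "(\<integral>\<^sup>+w. ennreal (bergman_kernel \<alpha> z w) * ennreal ((1 - (cmod w)\<^sup>2) powr (- s))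
        \<partial>weighted_disk_area \<alpha>) = ennreal I"
    "(\<lambda>n. schur_const \<alpha> s * gamma_ratio a s n * (pochhammer s n / fact n) * ((cmod z)\<^sup>2) ^ n) sums I"
    using bergman_kernel_integral_sums[OF \<alpha> s z a_def] by blast
  have s2: "s < 2 * a"
    using s by (simp add: a_def)
  define x where "x = (cmod z)\<^sup>2"
  define C where "C = schur_const \<alpha> s * gamma_ratio a s N"
  have x: "0 \<le> x" "x < 1"
    using z by (auto simp: x_def abs_square_less_1)
  have C: "C \<ge> 0"
    unfolding C_def
    by (intro mult_nonneg_nonneg less_imp_le[OF schur_const_pos[OF s]] less_imp_le[OF gamma_ratio_pos[OF s(1) s2]])
  have p: "pochhammer s n / fact n \<ge> 0" for n
    using s by (auto intro!: divide_nonneg_nonneg simp: pochhammer_nonneg)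
  \<comment> \<open>The binomial series with its first \<open>N\<close> terms removed. On the kernel
    side the corresponding terms are nonnegative and can be discarded.\<close>
  have "(\<lambda>n. pochhammer s n / fact n * x ^ n - (if n \<in> {..<N} then pochhammer s n / fact n * x ^ n else 0))
      sums ((1 - x) powr (- s) - (\<Sum>n<N. pochhammer s n / fact n * x ^ n))"
    using x by (intro sums_diff neg_binomial_real sums_If_finite_set) auto
  from sums_mult[OF this, of C] I(3)
  have "C * ((1 - x) powr (- s) - (\<Sum>n<N. pochhammer s n / fact n * x ^ n)) \<le> I"
  proof (rule sums_le[rotated])
    fix n
    show "C * (pochhammer s n / fact n * x ^ n - (if n \<in> {..<N} then pochhammer s n / fact n * x ^ n else 0))
       \<le> schur_const \<alpha> s * gamma_ratio a s n * (pochhammer s n / fact n) * ((cmod z)\<^sup>2) ^ n"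
    proof (cases "n < N")
      case True
      have "0 \<le> schur_const \<alpha> s * gamma_ratio a s n * (pochhammer s n / fact n) * ((cmod z)\<^sup>2) ^ n"
        by (intro mult_nonneg_nonneg p less_imp_le[OF schur_const_pos[OF s]]
            less_imp_le[OF gamma_ratio_pos[OF s(1) s2]]) simp
      with True show ?thesis
        by simp
    next
      case False
      then have "C \<le> schur_const \<alpha> s * gamma_ratio a s n"
        unfolding C_def
        using schur_const_pos[OF s] incseqD[OF incseq_gamma_ratio[OF s(1) s2], of N n]
        by (intro mult_left_mono) auto
      then have "C * (pochhammer s n / fact n * x ^ n) \<le>
          schur_const \<alpha> s * gamma_ratio a s n * (pochhammer s n / fact n * x ^ n)"
        using p[of n] x by (intro mult_right_mono mult_nonneg_nonneg) auto
      then show ?thesis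
        using False by (simp add: x_def mult_ac)
    qed
  qed
  \<comment> \<open>Replacing \<open>x\<close> by 1 in the removed polynomial makes the correction
    independent of \<open>z\<close>.\<close>
  moreover have "(\<Sum>n<N. pochhammer s n / fact n * x ^ n) \<le> (\<Sum>n<N. pochhammer s n / fact n)"
    using p x by (intro sum_mono mult_left_le power_le_one) auto
  then have "C * ((1 - x) powr (- s) - (\<Sum>n<N. pochhammer s n / fact n)) \<le>
      C * ((1 - x) powr (- s) - (\<Sum>n<N. pochhammer s n / fact n * x ^ n))"
    using C by (intro mult_left_mono) auto
  ultimately have "C * ((1 - x) powr (- s) - (\<Sum>n<N. pochhammer s n / fact n)) \<le> I"
    by linarith
  then show ?thesis
    unfolding I(2) C_def x_def a_def by (rule ennreal_leI)
qed

subsection \<open>Upper bound\<close>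

text \<open>This is Hoelder's inequality for the measure with density \<open>k\<close>, applied to
  the product of \<open>F / h\<close> and \<open>h\<close> and raised to the power \<open>p\<close>;
  it is obtained from Young's inequality. The number \<open>X\<close> is any finite lower bound, so
  the integral of \<open>k * F\<close> itself may be infinite a priori.\<close>

lemma schur_holder:
  fixes k h F :: "'a \<Rightarrow> real"
  assumes p: "1 < p" and q: "q = p / (p - 1)"
    and [measurable]: "k \<in> borel_measurable M" "h \<in> borel_measurable M" "F \<in> borel_measurable M"
    and nn: "\<And>x. x \<in> space M \<Longrightarrow> 0 \<le> k x" "\<And>x. x \<in> space M \<Longrightarrow> 0 < h x" "\<And>x. x \<in> space M \<Longrightarrow> 0 \<le> F x"
    and A: "A > 0" "(\<integral>\<^sup>+x. ennreal (k x * h x powr q) \<partial>M) \<le> ennreal A"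
    and X: "X \<ge> 0" "ennreal X \<le> (\<integral>\<^sup>+x. ennreal (k x * F x) \<partial>M)"
  shows "ennreal (X powr p) \<le> ennreal (A powr (p / q)) * (\<integral>\<^sup>+x. ennreal (k x * (F x / h x) powr p) \<partial>M)"
    (is "_ \<le> _ * ?B")
proof (cases "?B = \<infinity>")
  case True
  then show ?thesis
    using A(1) by (simp add: ennreal_mult_top)
next
  case False
  then obtain B where B: "B \<ge> 0" "?B = ennreal B"
    by (cases ?B) auto
  have q1: "q > 1"
    using p by (simp add: q field_simps)
  have pq: "1 / p + 1 / q = 1"
    using p by (simp add: q field_simps)
  show ?thesis
  \<comment> \<open>The scaling used below degenerates for \<open>B = 0\<close>; then
    \<open>k * F\<close> vanishes almost everywhere, which forces \<open>X = 0\<close>.\<close>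
  proof (cases "B = 0")
    case True
    have "AE x in M. ennreal (k x * (F x / h x) powr p) = 0"
      using B True by (subst nn_integral_0_iff_AE[symmetric]) auto
    then have "AE x in M. ennreal (k x * F x) = 0"
    proof (rule AE_mp, intro AE_I2 impI)
      fix x assume x: "x \<in> space M" "ennreal (k x * (F x / h x) powr p) = 0"
      then have "k x * (F x / h x) powr p \<le> 0"
        by (simp add: ennreal_eq_0_iff)
      then have "k x = 0 \<or> F x / h x = 0"
        using nn[OF x(1)] by (auto simp: mult_le_0_iff)
      then show "ennreal (k x * F x) = 0"
        using nn(2)[OF x(1)] by auto
    qed
    then have "(\<integral>\<^sup>+x. ennreal (k x * F x) \<partial>M) = 0"
      by (subst nn_integral_0_iff_AE) auto
    then have "X = 0"
      using X by (simp add: ennreal_eq_0_iff)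
    then show ?thesis
      by simp
  next
    case False
    then have Bp: "B > 0"
      using B(1) by simp
    \<comment> \<open>this scaling balances the two terms of Young's inequality\<close>
    define t where "t = (B / A) powr (1 / (p * q))"
    have t: "t > 0"
      using A Bp by (simp add: t_def)
    have tq: "t powr q = (B / A) powr (1 / p)" and tp: "t powr p = (B / A) powr (1 / q)"
      using p q1 by (auto simp: t_def powr_powr)
    have "(\<integral>\<^sup>+x. ennreal (k x * F x) \<partial>M) \<le>
        (\<integral>\<^sup>+x. ennreal (t powr q / q) * ennreal (k x * h x powr q) +
           ennreal (1 / (t powr p * p)) * ennreal (k x * (F x / h x) powr p) \<partial>M)"
    proof (rule nn_integral_mono)
      fix x assume x: "x \<in> space M"
      note nnx = nn[OF x]
      have "F x = (F x / h x / t) * (t * h x)"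
        using t nnx by simp
      also have "\<dots> \<le> (F x / h x / t) powr p / p + (t * h x) powr q / q"
        using p q1 pq t nnx by (intro Youngs_inequality) auto
      finally have "k x * F x \<le> k x * ((F x / h x / t) powr p / p + (t * h x) powr q / q)"
        using nnx by (intro mult_left_mono) auto
      also have "\<dots> = t powr q / q * (k x * h x powr q) + 1 / (t powr p * p) * (k x * (F x / h x) powr p)"
        using t nnx by (simp add: powr_mult powr_divide algebra_simps)
      finally have "ennreal (k x * F x) \<le>
          ennreal (t powr q / q * (k x * h x powr q) + 1 / (t powr p * p) * (k x * (F x / h x) powr p))"
        by (rule ennreal_leI)
      also have "\<dots> = ennreal (t powr q / q) * ennreal (k x * h x powr q) +
          ennreal (1 / (t powr p * p)) * ennreal (k x * (F x / h x) powr p)"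
      proof -
        have c: "0 \<le> t powr q / q" "0 \<le> 1 / (t powr p * p)"
          using p q1 by auto
        moreover have "0 \<le> k x * h x powr q" "0 \<le> k x * (F x / h x) powr p"
          using nnx by auto
        ultimately show ?thesis
          by (simp only: ennreal_plus mult_nonneg_nonneg ennreal_mult'[OF c(1)] ennreal_mult'[OF c(2)])
      qed
      finally show "ennreal (k x * F x) \<le> \<dots>" .
    qed
    also have "\<dots> = ennreal (t powr q / q) * (\<integral>\<^sup>+x. ennreal (k x * h x powr q) \<partial>M) +
        ennreal (1 / (t powr p * p)) * ?B"
      by (subst nn_integral_add) (auto simp: nn_integral_cmult)
    also have "\<dots> \<le> ennreal (t powr q / q) * ennreal A + ennreal (1 / (t powr p * p)) * ennreal B"
      using A(2) B(2) by (intro add_mono mult_left_mono) auto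
    also have "\<dots> = ennreal (t powr q / q * A + 1 / (t powr p * p) * B)"
    proof -
      have c: "0 \<le> t powr q / q" "0 \<le> 1 / (t powr p * p)"
        using p q1 by auto
      moreover have "0 \<le> A"
        using A by simp
      ultimately show ?thesis
        using B(1) by (simp only: ennreal_plus mult_nonneg_nonneg ennreal_mult'[OF c(1)] ennreal_mult'[OF c(2)])
    qed
    finally have "ennreal X \<le> ennreal (t powr q / q * A + 1 / (t powr p * p) * B)"
      using X(2) by (rule order_trans[rotated])
    then have "X \<le> t powr q / q * A + 1 / (t powr p * p) * B"
      using A B p q1 by (subst (asm) ennreal_le_iff) (auto intro!: add_nonneg_nonneg mult_nonneg_nonneg)
    also have "t powr q / q * A = A powr (1 / q) * B powr (1 / p) / q"
    proof -
      have "1 / q = 1 - 1 / p"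
        using pq by linarith
      then have "A powr (1 / q) = A / A powr (1 / p)"
        using A(1) by (simp only: powr_diff) simp
      then show ?thesis
        using A Bp by (simp add: tq powr_divide)
    qed
    also have "1 / (t powr p * p) * B = A powr (1 / q) * B powr (1 / p) / p"
    proof -
      have "1 / p = 1 - 1 / q"
        using pq by linarith
      then have "B powr (1 / p) = B / B powr (1 / q)"
        using Bp by (simp only: powr_diff) simp
      then show ?thesis
        using A Bp by (simp add: tp powr_divide)
    qed
    also have "A powr (1 / q) * B powr (1 / p) / q + A powr (1 / q) * B powr (1 / p) / p =
        A powr (1 / q) * B powr (1 / p) * (1 / p + 1 / q)"
      by (simp add: algebra_simps)
    finally have "X \<le> A powr (1 / q) * B powr (1 / p)"
      by (simp add: pq)
    then have "X powr p \<le> (A powr (1 / q) * B powr (1 / p)) powr p"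
      using X(1) p by (intro powr_mono2) auto
    also have "\<dots> = A powr (p / q) * B"
      using A Bp p by (simp add: powr_mult powr_powr)
    finally have "ennreal (X powr p) \<le> ennreal (A powr (p / q) * B)"
      by (rule ennreal_leI)
    then show ?thesis
      by (simp add: B(2) ennreal_mult')
  qed
qed

text \<open>The triangle inequality for integrals. For a non-integrable integrand the Bochner
  integral is 0 by convention, so the bound is trivial.\<close>

lemma cmod_maximal_bergman_le:
  "ennreal (cmod (maximal_bergman \<alpha> f z)) \<le>
    (\<integral>\<^sup>+w. ennreal (bergman_kernel \<alpha> z w * cmod (f w)) \<partial>weighted_disk_area \<alpha>)"
proof -
  let ?g = "\<lambda>w. f w / of_real (cmod (1 - z * cnj w) powr (2 + \<alpha>))"
  have n: "cmod (?g w) = bergman_kernel \<alpha> z w * cmod (f w)" for w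
    by (simp add: bergman_kernel_def norm_divide)
  show ?thesis
  proof (cases "integrable (weighted_disk_area \<alpha>) ?g")
    case True
    then show ?thesis
      unfolding maximal_bergman_def n[symmetric] by (rule integral_norm_bound_ennreal)
  next
    case False
    then show ?thesis
      by (simp add: maximal_bergman_def not_integrable_integral_eq)
  qed
qed

text \<open>The reflection exchanges the two Gamma factors. It maps
  \<open>(1 + \<alpha>) / p\<close> to \<open>(1 + \<alpha>) / q\<close>, hence the common constant
  in both Schur conditions.\<close>

lemma schur_const_reflect: "schur_const \<alpha> (1 + \<alpha> - s) = schur_const \<alpha> s"
  by (simp add: schur_const_def mult_ac)

text \<open>Schur's test with the weight \<open>(1 - \<bar>z\<bar>\<^sup>2)\<close> to the power \<open>- (1 + \<alpha>) / (p q)\<close>: both conditions hold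
  with the same constant.\<close>

lemma maximal_bergman_bounded:
  assumes p: "1 < p" and \<alpha>: "\<alpha> > -1"
    and f: "f \<in> borel_measurable (lebesgue_on (ball 0 1))"
  shows "(\<integral>\<^sup>+z. ennreal (cmod (maximal_bergman \<alpha> f z) powr p) \<partial>weighted_disk_area \<alpha>) \<le>
    ennreal (schur_const \<alpha> ((1 + \<alpha>) / p) powr p) *
      (\<integral>\<^sup>+z. ennreal (cmod (f z) powr p) \<partial>weighted_disk_area \<alpha>)"
proof -
  define q where "q = p / (p - 1)"
  define C where "C = schur_const \<alpha> ((1 + \<alpha>) / p)"
  define M where "M = weighted_disk_area \<alpha>"
  define \<delta> where "\<delta> = (\<lambda>z::complex. 1 - (cmod z)\<^sup>2)"
  define h where "h = (\<lambda>z. \<delta> z powr (- ((1 + \<alpha>) / (p * q))))"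
  interpret M: finite_measure M
    unfolding M_def by (rule finite_measure_weighted_disk_area[OF \<alpha>])
  interpret MM: pair_sigma_finite M M ..
  have q1: "q > 1"
    using p by (simp add: q_def field_simps)
  have pq: "1 / p + 1 / q = 1"
    using p by (simp add: q_def field_simps)
  have sp: "0 < (1 + \<alpha>) / p" "(1 + \<alpha>) / p < 1 + \<alpha>" and sq: "0 < (1 + \<alpha>) / q" "(1 + \<alpha>) / q < 1 + \<alpha>"
    using p q1 \<alpha> mult_strict_left_mono[of 1 p "1 + \<alpha>"] mult_strict_left_mono[of 1 q "1 + \<alpha>"]
    by (auto simp: divide_less_eq)
  have C: "C > 0"
    unfolding C_def by (rule schur_const_pos[OF sp])
  have "(1 + \<alpha>) / q = 1 + \<alpha> - (1 + \<alpha>) / p"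
    using p by (simp add: q_def field_simps)
  then have Cq: "schur_const \<alpha> ((1 + \<alpha>) / q) = C"
    by (simp add: C_def schur_const_reflect)
  have fM [measurable]: "f \<in> borel_measurable M"
    using f by (simp add: M_def)
  have id [measurable]: "(\<lambda>z. z) \<in> borel_measurable M"
    by (simp add: M_def borel_measurable_imp_lebesgue_on)
  have \<delta>_meas [measurable]: "\<delta> \<in> borel_measurable M"
    unfolding \<delta>_def by measurable
  have h_meas [measurable]: "h \<in> borel_measurable M"
    unfolding h_def by measurable
  have space: "space M = ball 0 1"
    by (simp add: M_def)
  have \<delta>: "\<delta> z > 0" if "z \<in> space M" for z
    using that by (simp add: \<delta>_def space abs_square_less_1)
  have h: "h z > 0" if "z \<in> space M" for z
    using \<delta>[OF that] by (simp add: h_def)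
  have hq: "h z powr q = \<delta> z powr (- ((1 + \<alpha>) / p))"
    and hp: "h z powr p = \<delta> z powr (- ((1 + \<alpha>) / q))" for z
    using p q1 by (simp_all add: h_def powr_powr)
  have schur: "(\<integral>\<^sup>+w. ennreal (bergman_kernel \<alpha> z w * h w powr q) \<partial>M) \<le> ennreal (C * h z powr q)"
      "(\<integral>\<^sup>+w. ennreal (bergman_kernel \<alpha> z w * h w powr p) \<partial>M) \<le> ennreal (C * h z powr p)"
    if "z \<in> space M" for z
    using bergman_kernel_integral_le[OF \<alpha> sp, of z] bergman_kernel_integral_le[OF \<alpha> sq, of z] that
    by (simp_all add: hq hp space M_def \<delta>_def Cq ennreal_mult' flip: C_def)
  have pointwise: "ennreal (cmod (maximal_bergman \<alpha> f z) powr p) \<le> ennreal (C powr (p / q) * h z powr p) *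
      (\<integral>\<^sup>+w. ennreal (bergman_kernel \<alpha> z w * (cmod (f w) / h w) powr p) \<partial>M)"
    if z: "z \<in> space M" for z
  proof -
    \<comment> \<open>The first Schur condition supplies the constant \<open>A\<close> of Hoelder's
      inequality as \<open>C * h z powr q\<close>.\<close>
    have "ennreal (cmod (maximal_bergman \<alpha> f z) powr p) \<le> ennreal ((C * h z powr q) powr (p / q)) *
      (\<integral>\<^sup>+w. ennreal (bergman_kernel \<alpha> z w * (cmod (f w) / h w) powr p) \<partial>M)"
    proof (rule schur_holder[OF p q_def])
      show "bergman_kernel \<alpha> z \<in> borel_measurable M"
        by measurable
      show "ennreal (cmod (maximal_bergman \<alpha> f z)) \<le> (\<integral>\<^sup>+w. ennreal (bergman_kernel \<alpha> z w * cmod (f w)) \<partial>M)"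
        unfolding M_def by (rule cmod_maximal_bergman_le)
    qed (use C h[OF z] h schur(1)[OF z] in auto)
    also have "(C * h z powr q) powr (p / q) = C powr (p / q) * h z powr p"
      using C q1 by (simp add: powr_mult powr_powr)
    finally show ?thesis .
  qed
  have "(\<integral>\<^sup>+z. ennreal (cmod (maximal_bergman \<alpha> f z) powr p) \<partial>M) \<le>
      (\<integral>\<^sup>+z. (\<integral>\<^sup>+w. ennreal (C powr (p / q) * (h z powr p * (bergman_kernel \<alpha> z w * (cmod (f w) / h w) powr p))) \<partial>M) \<partial>M)"
  proof (rule nn_integral_mono)
    fix z assume "z \<in> space M"
    note pointwise[OF this]
    also have "ennreal (C powr (p / q) * h z powr p) *
        (\<integral>\<^sup>+w. ennreal (bergman_kernel \<alpha> z w * (cmod (f w) / h w) powr p) \<partial>M) =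
        (\<integral>\<^sup>+w. ennreal (C powr (p / q) * (h z powr p * (bergman_kernel \<alpha> z w * (cmod (f w) / h w) powr p))) \<partial>M)"
      by (subst nn_integral_cmult[symmetric]) (auto simp: ennreal_mult' mult.assoc)
    finally show "ennreal (cmod (maximal_bergman \<alpha> f z) powr p) \<le> \<dots>" .
  qed
  \<comment> \<open>Tonelli makes \<open>z\<close> the inner variable. There the power of
    \<open>h z\<close> left over from Hoelder's inequality meets the kernel, and the second Schur
    condition applies by symmetry.\<close>
  also have "\<dots> = (\<integral>\<^sup>+w. (\<integral>\<^sup>+z. ennreal (C powr (p / q) * (h z powr p * (bergman_kernel \<alpha> z w * (cmod (f w) / h w) powr p))) \<partial>M) \<partial>M)"
    by (rule MM.Fubini'[symmetric]) measurable
  also have "\<dots> \<le> (\<integral>\<^sup>+w. ennreal (C powr p) * ennreal (cmod (f w) powr p) \<partial>M)"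
  proof (rule nn_integral_mono)
    fix w assume w: "w \<in> space M"
    have "(\<integral>\<^sup>+z. ennreal (C powr (p / q) * (h z powr p * (bergman_kernel \<alpha> z w * (cmod (f w) / h w) powr p))) \<partial>M) =
        ennreal (C powr (p / q) * (cmod (f w) / h w) powr p) * (\<integral>\<^sup>+z. ennreal (bergman_kernel \<alpha> w z * h z powr p) \<partial>M)"
      by (subst nn_integral_cmult[symmetric])
        (auto simp: bergman_kernel_commute[of \<alpha> _ w] ennreal_mult' mult_ac)
    also have "\<dots> \<le> ennreal (C powr (p / q) * (cmod (f w) / h w) powr p) * ennreal (C * h w powr p)"
      by (intro mult_left_mono schur w) auto
    also have "\<dots> = ennreal (C powr (p / q + 1) * cmod (f w) powr p)"
      using C h[OF w] by (simp add: powr_add powr_divide flip: ennreal_mult')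
    \<comment> \<open>Hoelder's inequality contributes \<open>C powr (p / q)\<close> and the second
      Schur condition one more factor \<open>C\<close>.\<close>
    also have "p / q + 1 = p"
      using p by (simp add: q_def)
    finally show "(\<integral>\<^sup>+z. ennreal (C powr (p / q) * (h z powr p * (bergman_kernel \<alpha> z w * (cmod (f w) / h w) powr p))) \<partial>M)
       \<le> ennreal (C powr p) * ennreal (cmod (f w) powr p)"
      by (simp add: ennreal_mult')
  qed
  also have "\<dots> = ennreal (C powr p) * (\<integral>\<^sup>+w. ennreal (cmod (f w) powr p) \<partial>M)"
    by (rule nn_integral_cmult) measurable
  finally show ?thesis
    unfolding M_def C_def .
qed

section \<open>From integral estimates to the operator norm\<close>

lemma AE_weighted_disk_area_iff:
  assumes \<alpha>: "\<alpha> > -1"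
  shows "(AE z in weighted_disk_area \<alpha>. P z) \<longleftrightarrow> (AE z in lebesgue_on (ball 0 1). P z)"
proof -
  let ?h = "\<lambda>z. ennreal ((1 + \<alpha>) * (1 - (cmod z)\<^sup>2) powr \<alpha>)"
  have h: "?h \<in> borel_measurable (lebesgue_on (ball 0 1))"
    by (intro borel_measurable_imp_lebesgue_on) measurable
  \<comment> \<open>Strict positivity of the density on the open disk is what makes the null sets
    coincide.\<close>
  have pos: "?h z > 0" if "z \<in> ball 0 1" for z
  proof -
    have "(cmod z)\<^sup>2 < 1"
      using that by (simp add: abs_square_less_1)
    then show ?thesis
      using \<alpha> by (auto intro!: mult_pos_pos)
  qed
  have "(AE z in weighted_disk_area \<alpha>. P z) \<longleftrightarrow> (AE z in disk_area. 0 < ?h z \<longrightarrow> P z)"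
    unfolding weighted_disk_area_def by (rule AE_density) (use h in \<open>simp add: disk_area_def\<close>)
  also have "\<dots> \<longleftrightarrow> (AE z in lebesgue_on (ball 0 1). 0 < ennreal (1 / pi) \<longrightarrow> 0 < ?h z \<longrightarrow> P z)"
    unfolding disk_area_def by (rule AE_density) simp
  also have "\<dots> \<longleftrightarrow> (AE z in lebesgue_on (ball 0 1). P z)"
    by (rule AE_cong) (use pos in auto)
  finally show ?thesis .
qed

lemma disk_Lp_integral_eq_0_iff:
  assumes \<alpha>: "\<alpha> > -1" and f: "f \<in> borel_measurable (lebesgue_on (ball 0 1))"
  shows "(\<integral>\<^sup>+z. ennreal (cmod (f z) powr p) \<partial>weighted_disk_area \<alpha>) = 0 \<longleftrightarrow>
    (AE z in lebesgue_on (ball 0 1). f z = 0)"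
proof -
  have [measurable]: "f \<in> borel_measurable (weighted_disk_area \<alpha>)"
    using f by simp
  have "(\<integral>\<^sup>+z. ennreal (cmod (f z) powr p) \<partial>weighted_disk_area \<alpha>) = 0 \<longleftrightarrow>
      (AE z in weighted_disk_area \<alpha>. ennreal (cmod (f z) powr p) = 0)"
    by (rule nn_integral_0_iff_AE) measurable
  then show ?thesis
    by (simp add: AE_weighted_disk_area_iff[OF \<alpha>] ennreal_eq_0_iff)
qed

lemma disk_Lp_norm_eq:
  assumes "(\<integral>\<^sup>+z. ennreal (cmod (f z) powr p) \<partial>weighted_disk_area \<alpha>) = ennreal r" "r \<ge> 0"
  shows "disk_Lp_norm p \<alpha> f = ennreal (r powr (1 / p))"
  using assms by (simp add: disk_Lp_norm_def)

text \<open>Take \<open>p\<close>-th roots in the integral estimate. Both norms are finite and the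
  one of \<open>f\<close> is positive, so the extended quotient is an ordinary real
  quotient.\<close>

lemma maximal_bergman_norm_le:
  assumes p: "1 < p" and \<alpha>: "\<alpha> > -1"
  shows "maximal_bergman_norm p \<alpha> \<le> ennreal (schur_const \<alpha> ((1 + \<alpha>) / p))"
  unfolding maximal_bergman_norm_def
proof (rule SUP_least)
  let ?C = "schur_const \<alpha> ((1 + \<alpha>) / p)"
  have "(1 + \<alpha>) / p < 1 + \<alpha>"
    using p \<alpha> mult_strict_left_mono[of 1 p "1 + \<alpha>"] by (auto simp: divide_less_eq)
  then have C: "?C > 0"
    using p \<alpha> by (intro schur_const_pos) auto
  fix f assume "f \<in> {f \<in> disk_Lp p \<alpha>. \<not> (AE z in lebesgue_on (ball 0 1). f z = 0)}"
  then have f: "f \<in> borel_measurable (lebesgue_on (ball 0 1))" "disk_Lp_norm p \<alpha> f < \<infinity>"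
      "\<not> (AE z in lebesgue_on (ball 0 1). f z = 0)"
    by (auto simp: disk_Lp_def)
  obtain r where r: "(\<integral>\<^sup>+z. ennreal (cmod (f z) powr p) \<partial>weighted_disk_area \<alpha>) = ennreal r" "r \<ge> 0"
    using f(2) by (cases "\<integral>\<^sup>+z. ennreal (cmod (f z) powr p) \<partial>weighted_disk_area \<alpha>")
      (auto simp: disk_Lp_norm_def)
  have "r > 0"
    using disk_Lp_integral_eq_0_iff[OF \<alpha> f(1), of p] f(3) r by (cases "r = 0") auto
  have le: "(\<integral>\<^sup>+z. ennreal (cmod (maximal_bergman \<alpha> f z) powr p) \<partial>weighted_disk_area \<alpha>) \<le>
      ennreal (?C powr p * r)"
    using maximal_bergman_bounded[OF p \<alpha> f(1)] by (simp add: r(1) ennreal_mult')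
  then obtain r' where r': "(\<integral>\<^sup>+z. ennreal (cmod (maximal_bergman \<alpha> f z) powr p) \<partial>weighted_disk_area \<alpha>) =
      ennreal r'" "r' \<ge> 0"
    by (cases "\<integral>\<^sup>+z. ennreal (cmod (maximal_bergman \<alpha> f z) powr p) \<partial>weighted_disk_area \<alpha>")
      (auto simp: top_unique)
  then have "r' \<le> ?C powr p * r"
    using le r by simp
  then have "r' powr (1 / p) \<le> (?C powr p * r) powr (1 / p)"
    using r' p by (intro powr_mono2) auto
  also have "\<dots> = ?C * r powr (1 / p)"
    using C p r by (simp add: powr_mult powr_powr)
  finally have "r' powr (1 / p) / r powr (1 / p) \<le> ?C"
    using \<open>r > 0\<close> by (simp add: divide_le_eq)
  moreover have "disk_Lp_norm p \<alpha> (maximal_bergman \<alpha> f) / disk_Lp_norm p \<alpha> f =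
      ennreal (r' powr (1 / p) / r powr (1 / p))"
    unfolding disk_Lp_norm_eq[OF r'] disk_Lp_norm_eq[OF r] using \<open>r > 0\<close> by (intro divide_ennreal) auto
  ultimately show "disk_Lp_norm p \<alpha> (maximal_bergman \<alpha> f) / disk_Lp_norm p \<alpha> f \<le> ennreal ?C"
    by (simp add: ennreal_leI)
qed

subsection \<open>Lower bound\<close>

definition test_function :: "real \<Rightarrow> complex \<Rightarrow> complex" where
  "test_function s w = of_real ((1 - (cmod w)\<^sup>2) powr (- s))"

lemma borel_measurable_test_function [measurable]: "test_function s \<in> borel_measurable borel"
  unfolding test_function_def by measurable

lemma cmod_test_function [simp]: "cmod (test_function s w) = (1 - (cmod w)\<^sup>2) powr (- s)"
  by (simp add: test_function_def)

text \<open>These integrals grow without bound as \<open>s * p\<close> increases to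
  \<open>1 + \<alpha>\<close>, which will make bounded errors negligible.\<close>

lemma test_function_integral:
  assumes "\<alpha> > -1" "s * p < 1 + \<alpha>"
  shows "(\<integral>\<^sup>+z. ennreal (cmod (test_function s z) powr p) \<partial>weighted_disk_area \<alpha>) =
    ennreal ((1 + \<alpha>) / (1 + \<alpha> - s * p))"
  using nn_integral_weighted_disk_area_powr_const[OF assms] by (simp add: powr_powr)

text \<open>The integrand is nonnegative and, by the upper estimate, integrable, so the Bochner
  integral agrees with the extended one and the lower estimate transfers to the operator.\<close>

lemma cmod_maximal_bergman_test_function:
  assumes \<alpha>: "\<alpha> > -1" and s: "0 < s" "s < 1 + \<alpha>" and z: "cmod z < 1"
  shows "ennreal (cmod (maximal_bergman \<alpha> (test_function s) z)) =
    (\<integral>\<^sup>+w. ennreal (bergman_kernel \<alpha> z w) * ennreal ((1 - (cmod w)\<^sup>2) powr (- s)) \<partial>weighted_disk_area \<alpha>)"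
proof -
  let ?g = "\<lambda>w. bergman_kernel \<alpha> z w * (1 - (cmod w)\<^sup>2) powr (- s)"
  have "?g \<in> borel_measurable borel"
    by measurable
  then have meas: "?g \<in> borel_measurable (weighted_disk_area \<alpha>)"
    by (simp add: borel_measurable_imp_lebesgue_on)
  have "(\<integral>\<^sup>+w. ennreal (?g w) \<partial>weighted_disk_area \<alpha>) < \<infinity>"
    using bergman_kernel_integral_le[OF assms] by (auto simp: ennreal_mult' intro: le_less_trans)
  then have int: "integrable (weighted_disk_area \<alpha>) ?g"
    by (intro integrableI_nonneg meas) auto
  have "maximal_bergman \<alpha> (test_function s) z = (\<integral>w. complex_of_real (?g w) \<partial>weighted_disk_area \<alpha>)"
    by (simp add: maximal_bergman_def test_function_def bergman_kernel_def)
  also have "\<dots> = complex_of_real (\<integral>w. ?g w \<partial>weighted_disk_area \<alpha>)"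
    by (rule integral_complex_of_real)
  finally have "cmod (maximal_bergman \<alpha> (test_function s) z) = (\<integral>w. ?g w \<partial>weighted_disk_area \<alpha>)"
    by simp
  then show ?thesis
    using nn_integral_eq_integral[OF int] by (simp add: ennreal_mult')
qed

text \<open>Either \<open>S\<close> is at most \<open>\<eta> * F\<close>, and subtracting it costs
  at most the factor \<open>1 - \<eta>\<close>, or \<open>F\<close> is below
  \<open>S / \<eta>\<close>. The error term thus does not depend on \<open>F\<close>.\<close>

lemma powr_diff_lower_bound:
  fixes F S \<eta> p :: real
  assumes "F \<ge> 0" "S \<ge> 0" "0 < \<eta>" "\<eta> < 1" "p > 0"
  shows "(1 - \<eta>) powr p * F powr p \<le> (max 0 (F - S)) powr p + (S / \<eta>) powr p"
proof (cases "S \<le> \<eta> * F")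
  case True
  then have "(1 - \<eta>) * F \<le> max 0 (F - S)"
    by (simp add: algebra_simps)
  then have "((1 - \<eta>) * F) powr p \<le> (max 0 (F - S)) powr p"
    using assms by (intro powr_mono2) auto
  then show ?thesis
    using assms by (simp add: powr_mult) (smt (verit) powr_ge_zero)
next
  case False
  then have "F \<le> S / \<eta>"
    using assms by (simp add: field_simps)
  moreover have "(1 - \<eta>) * F \<le> 1 * F"
    using assms by (intro mult_right_mono) auto
  ultimately have "((1 - \<eta>) * F) powr p \<le> (S / \<eta>) powr p"
    using assms by (intro powr_mono2) auto
  then show ?thesis
    using assms by (simp add: powr_mult) (smt (verit) powr_ge_zero)
qed

text \<open>Integrate the preceding inequality against the kernel lower bound. The total mass is 1,
  so the error remains a constant, and dividing by the integral of the test function gives it the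
  small factor \<open>(1 + \<alpha> - s * p) / (1 + \<alpha>)\<close>.\<close>

lemma test_function_lower_bound:
  fixes N :: nat
  assumes p: "1 < p" and \<alpha>: "\<alpha> > -1" and s: "0 < s" "s < (1 + \<alpha>) / p" and \<eta>: "0 < \<eta>" "\<eta> < 1"
    and B: "B \<ge> 0" "maximal_bergman_norm p \<alpha> \<le> ennreal B"
  defines "K \<equiv> schur_const \<alpha> s * gamma_ratio ((2 + \<alpha>) / 2) s N"
    and "S \<equiv> (\<Sum>n<N. pochhammer s n / fact n)"
  shows "(K * (1 - \<eta>)) powr p \<le> B powr p + (K * S / \<eta>) powr p * ((1 + \<alpha> - s * p) / (1 + \<alpha>))"
proof -
  define M where "M = weighted_disk_area \<alpha>"
  define F where "F = (\<lambda>z. (1 - (cmod z)\<^sup>2) powr (- s))"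
  define I where "I = (1 + \<alpha>) / (1 + \<alpha> - s * p)"
  let ?P = "maximal_bergman \<alpha> (test_function s)"
  have sp: "s * p < 1 + \<alpha>"
    using s p by (simp add: field_simps)
  have "s * 1 \<le> s * p"
    using s p by (intro mult_left_mono) auto
  then have s1: "s < 1 + \<alpha>"
    using sp by simp
  have I: "I > 0"
    using sp \<alpha> by (simp add: I_def)
  have K: "K \<ge> 0"
    unfolding K_def using s(1) s1
    by (intro mult_nonneg_nonneg less_imp_le[OF schur_const_pos] less_imp_le[OF gamma_ratio_pos]) auto
  have S: "S \<ge> 0"
    unfolding S_def using s(1) by (intro sum_nonneg divide_nonneg_nonneg) (auto simp: pochhammer_nonneg)
  have F_meas [measurable]: "F \<in> borel_measurable M"
    unfolding M_def F_def borel_measurable_weighted_disk_area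
    by (rule borel_measurable_imp_lebesgue_on) measurable
  have intF: "(\<integral>\<^sup>+z. ennreal (F z powr p) \<partial>M) = ennreal I"
    using test_function_integral[OF \<alpha> sp] by (simp add: M_def F_def I_def)
  have one: "emeasure M (space M) = 1"
    unfolding M_def by (rule emeasure_weighted_disk_area_space[OF \<alpha>])
  have f_meas: "test_function s \<in> borel_measurable (lebesgue_on (ball 0 1))"
    by (rule borel_measurable_imp_lebesgue_on) simp
  have normf: "disk_Lp_norm p \<alpha> (test_function s) = ennreal (I powr (1 / p))"
    using I test_function_integral[OF \<alpha> sp] by (intro disk_Lp_norm_eq) (auto simp: I_def)
  have "(\<integral>\<^sup>+z. ennreal (cmod (?P z) powr p) \<partial>M) \<le>
      ennreal (schur_const \<alpha> ((1 + \<alpha>) / p) powr p) * ennreal I"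
    using maximal_bergman_bounded[OF p \<alpha> f_meas] test_function_integral[OF \<alpha> sp] by (simp add: M_def I_def)
  also have "\<dots> < \<infinity>"
    by (simp add: ennreal_mult_less_top)
  \<comment> \<open>The upper bound guarantees a finite integral, which permits real arithmetic from
    here on.\<close>
  finally obtain r where r: "(\<integral>\<^sup>+z. ennreal (cmod (?P z) powr p) \<partial>M) = ennreal r" "r \<ge> 0"
    by (cases "\<integral>\<^sup>+z. ennreal (cmod (?P z) powr p) \<partial>M") auto
  have rB: "r \<le> B powr p * I"
  proof -
    have "\<not> (AE z in lebesgue_on (ball 0 1). test_function s z = 0)"
      using disk_Lp_integral_eq_0_iff[OF \<alpha> f_meas, of p] test_function_integral[OF \<alpha> sp] I
      by (auto simp: I_def)
    then have "disk_Lp_norm p \<alpha> ?P / disk_Lp_norm p \<alpha> (test_function s) \<le> maximal_bergman_norm p \<alpha>"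
      unfolding maximal_bergman_norm_def using f_meas normf by (intro SUP_upper) (auto simp: disk_Lp_def)
    also note B(2)
    also have "disk_Lp_norm p \<alpha> ?P / disk_Lp_norm p \<alpha> (test_function s) =
        ennreal (r powr (1 / p) / I powr (1 / p))"
      unfolding disk_Lp_norm_eq[OF r[unfolded M_def]] normf using I by (intro divide_ennreal) auto
    finally have "r powr (1 / p) / I powr (1 / p) \<le> B"
      using B(1) by simp
    then have "r powr (1 / p) \<le> B * I powr (1 / p)"
      using I by (simp add: divide_le_eq)
    then have "(r powr (1 / p)) powr p \<le> (B * I powr (1 / p)) powr p"
      using p by (intro powr_mono2) auto
    then show ?thesis
      using p r I B by (simp add: powr_mult powr_powr)
  qed
  have "ennreal ((K * (1 - \<eta>)) powr p * I) = (\<integral>\<^sup>+z. ennreal ((K * (1 - \<eta>)) powr p) * ennreal (F z powr p) \<partial>M)"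
    by (subst nn_integral_cmult) (auto simp: intF ennreal_mult')
  also have "\<dots> \<le> (\<integral>\<^sup>+z. ennreal ((K * max 0 (F z - S)) powr p) + ennreal ((K * S / \<eta>) powr p) \<partial>M)"
  proof (rule nn_integral_mono)
    fix z
    have "K powr p * ((1 - \<eta>) powr p * F z powr p) \<le>
        K powr p * ((max 0 (F z - S)) powr p + (S / \<eta>) powr p)"
      using S \<eta> p by (intro mult_left_mono powr_diff_lower_bound) (auto simp: F_def)
    then have "(K * (1 - \<eta>)) powr p * F z powr p \<le> (K * max 0 (F z - S)) powr p + (K * (S / \<eta>)) powr p"
      using K S \<eta> by (simp only: powr_mult) (simp add: algebra_simps)
    then have "ennreal ((K * (1 - \<eta>)) powr p * F z powr p) \<le>
        ennreal ((K * max 0 (F z - S)) powr p + (K * S / \<eta>) powr p)"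
      by (intro ennreal_leI) simp
    then show "ennreal ((K * (1 - \<eta>)) powr p) * ennreal (F z powr p) \<le>
        ennreal ((K * max 0 (F z - S)) powr p) + ennreal ((K * S / \<eta>) powr p)"
      by (simp add: ennreal_mult')
  qed
  also have "\<dots> = (\<integral>\<^sup>+z. ennreal ((K * max 0 (F z - S)) powr p) \<partial>M) + ennreal ((K * S / \<eta>) powr p)"
    by (subst nn_integral_add) (auto simp: one)
  also have "\<dots> \<le> ennreal r + ennreal ((K * S / \<eta>) powr p)"
    unfolding r(1)[symmetric]
  proof (intro add_right_mono nn_integral_mono)
    fix z assume "z \<in> space M"
    then have z: "cmod z < 1"
      by (simp add: M_def)
    have "ennreal (K * (F z - S)) \<le> ennreal (cmod (?P z))"
      unfolding cmod_maximal_bergman_test_function[OF \<alpha> s(1) s1 z] K_def F_def S_def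
      by (rule bergman_kernel_integral_ge[OF \<alpha> s(1) s1 z])
    then have "K * (F z - S) \<le> cmod (?P z)"
      by simp
    \<comment> \<open>Truncation at 0 is harmless because the right-hand side is nonnegative, and it
      makes the \<open>p\<close>-th power monotone.\<close>
    then have "K * max 0 (F z - S) \<le> cmod (?P z)"
      by (simp add: max_def)
    then show "ennreal ((K * max 0 (F z - S)) powr p) \<le> ennreal (cmod (?P z) powr p)"
      using K p by (intro ennreal_leI powr_mono2) auto
  qed
  also have "\<dots> = ennreal (r + (K * S / \<eta>) powr p)"
    using r by simp
  finally have "(K * (1 - \<eta>)) powr p * I \<le> r + (K * S / \<eta>) powr p"
    using r by (subst (asm) ennreal_le_iff) auto
  also have "\<dots> \<le> (B powr p + (K * S / \<eta>) powr p * (1 / I)) * I"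
    using rB I by (simp add: algebra_simps)
  finally have "(K * (1 - \<eta>)) powr p \<le> B powr p + (K * S / \<eta>) powr p * (1 / I)"
    using I by simp
  then show ?thesis
    by (simp add: I_def)
qed

text \<open>Three limits in this order: for fixed \<open>N\<close> and \<open>\<eta>\<close>, let
  \<open>s\<close> increase to \<open>(1 + \<alpha>) / p\<close>, which removes the error; then let
  \<open>N\<close> tend to infinity, so that the Gamma ratio tends to 1; finally let
  \<open>\<eta>\<close> tend to 0.\<close>

lemma schur_const_le_maximal_bergman_norm:
  assumes p: "1 < p" and \<alpha>: "\<alpha> > -1" and B: "B \<ge> 0" "maximal_bergman_norm p \<alpha> \<le> ennreal B"
  shows "schur_const \<alpha> ((1 + \<alpha>) / p) \<le> B"
proof -
  define s0 where "s0 = (1 + \<alpha>) / p"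
  define a where "a = (2 + \<alpha>) / 2"
  define C where "C = schur_const \<alpha> s0"
  have s0: "0 < s0" "s0 < 1 + \<alpha>"
    using p \<alpha> mult_strict_left_mono[of 1 p "1 + \<alpha>"] by (auto simp: s0_def divide_less_eq)
  have s0a: "s0 < 2 * a"
    using s0 by (simp add: a_def)
  have C: "C > 0"
    unfolding C_def by (rule schur_const_pos[OF s0])
  have np: "x \<notin> \<int>\<^sub>\<le>\<^sub>0" if "x > 0" for x :: real
    using that by auto
  have step: "C * gamma_ratio a s0 N * (1 - \<eta>) \<le> B" if \<eta>: "0 < \<eta>" "\<eta> < 1" for N \<eta>
  proof -
    define K where "K = (\<lambda>s. schur_const \<alpha> s * gamma_ratio a s N)"
    define S where "S = (\<lambda>s::real. \<Sum>n<N. pochhammer s n / fact n)"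
    have ap: "a > 0"
      using \<alpha> by (simp add: a_def)
    have [tendsto_intros]: "(schur_const \<alpha> \<longlongrightarrow> schur_const \<alpha> s0) (at_left s0)"
      unfolding schur_const_def a_def[symmetric] using s0 Gamma_real_pos[OF ap]
      by (intro tendsto_intros np) auto
    have [tendsto_intros]: "((\<lambda>s. gamma_ratio a s N) \<longlongrightarrow> gamma_ratio a s0 N) (at_left s0)"
    proof -
      have "0 < 2 * a - s0 + real N" "0 < s0 + real N"
        using s0 s0a by auto
      note this this[THEN Gamma_real_pos, THEN less_imp_neq, THEN not_sym]
      then show ?thesis
        unfolding gamma_ratio_def by (intro tendsto_intros np) auto
    qed
    have K: "(K \<longlongrightarrow> K s0) (at_left s0)"
      unfolding K_def by (intro tendsto_intros)
    have S: "(S \<longlongrightarrow> S s0) (at_left s0)"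
      unfolding S_def pochhammer_prod by (intro tendsto_intros) auto
    have "K s0 > 0"
      unfolding K_def by (intro mult_pos_pos schur_const_pos gamma_ratio_pos s0 s0a)
    \<comment> \<open>For \<open>N = 0\<close> the sum is empty and the base of the power is 0, so
      continuity of \<open>powr\<close> in the base also asks for eventual nonnegativity.\<close>
    have nn: "\<forall>\<^sub>F s in at_left s0. 0 \<le> K s * S s / \<eta>"
      using eventually_at_left_real[OF s0(1)]
    proof eventually_elim
      case (elim s)
      then have "0 < K s"
        unfolding K_def using s0 s0a by (intro mult_pos_pos schur_const_pos gamma_ratio_pos) auto
      moreover have "0 \<le> S s"
        unfolding S_def using elim by (intro sum_nonneg divide_nonneg_nonneg) (auto simp: pochhammer_nonneg)
      ultimately show ?case
        using \<eta> by simp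
    qed
    have "((\<lambda>s. B powr p + (K s * S s / \<eta>) powr p * ((1 + \<alpha> - s * p) / (1 + \<alpha>))) \<longlongrightarrow>
        B powr p + (K s0 * S s0 / \<eta>) powr p * ((1 + \<alpha> - s0 * p) / (1 + \<alpha>))) (at_left s0)"
      using \<eta> p \<alpha> nn by (intro tendsto_intros K S tendsto_powr') auto
    moreover have "((\<lambda>s. (K s * (1 - \<eta>)) powr p) \<longlongrightarrow> (K s0 * (1 - \<eta>)) powr p) (at_left s0)"
      using \<eta> p \<open>K s0 > 0\<close> by (intro tendsto_intros K) auto
    moreover have "\<forall>\<^sub>F s in at_left s0. (K s * (1 - \<eta>)) powr p \<le>
        B powr p + (K s * S s / \<eta>) powr p * ((1 + \<alpha> - s * p) / (1 + \<alpha>))"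
      using eventually_at_left_real[OF s0(1)]
    proof eventually_elim
      case (elim s)
      then show ?case
        unfolding K_def S_def a_def
        using test_function_lower_bound[OF p \<alpha> _ _ \<eta> B, of s N] by (simp add: s0_def)
    qed
    ultimately have "(K s0 * (1 - \<eta>)) powr p \<le>
        B powr p + (K s0 * S s0 / \<eta>) powr p * ((1 + \<alpha> - s0 * p) / (1 + \<alpha>))"
      by (intro tendsto_le[of "at_left s0"]) auto
    \<comment> \<open>At the critical exponent the factor of the error term is zero.\<close>
    also have "s0 * p = 1 + \<alpha>"
      using p by (simp add: s0_def)
    finally have "(K s0 * (1 - \<eta>)) powr p \<le> B powr p"
      by simp
    then have "K s0 * (1 - \<eta>) \<le> B"
      using p B(1) \<open>K s0 > 0\<close> \<eta> by (smt (verit) powr_less_mono2)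
    then show ?thesis
      by (simp add: K_def C_def)
  qed
  have "C * (1 - \<eta>) \<le> B" if \<eta>: "0 < \<eta>" "\<eta> < 1" for \<eta>
  proof (rule LIMSEQ_le_const2)
    have "(\<lambda>N. C * gamma_ratio a s0 N * (1 - \<eta>)) \<longlonglongrightarrow> C * 1 * (1 - \<eta>)"
      by (intro tendsto_intros gamma_ratio_tendsto_1 s0 s0a)
    then show "(\<lambda>N. C * gamma_ratio a s0 N * (1 - \<eta>)) \<longlonglongrightarrow> C * (1 - \<eta>)"
      by simp
  qed (use step[OF \<eta>] in auto)
  then have "\<forall>\<^sub>F \<eta> in at_right 0. C * (1 - \<eta>) \<le> B"
    using eventually_at_right_real[of 0 "1::real"] by (auto elim!: eventually_mono)
  moreover have "((\<lambda>\<eta>. C * (1 - \<eta>)) \<longlongrightarrow> C * (1 - 0)) (at_right 0)"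
    by (intro tendsto_intros)
  ultimately have "C * (1 - 0) \<le> B"
    by (intro tendsto_upperbound[of "\<lambda>\<eta>. C * (1 - \<eta>)" _ "at_right 0"]) auto
  then show ?thesis
    by (simp add: C_def s0_def)
qed

theorem proposition3p1:
  fixes p q \<alpha> :: real
  assumes "1 < p" and "-1 < \<alpha>" and "q = p / (p - 1)"
  shows "maximal_bergman_norm p \<alpha> =
           ennreal ((1 + \<alpha>) * Gamma ((1 + \<alpha>) / p) * Gamma ((1 + \<alpha>) / q)
                      / (Gamma ((2 + \<alpha>) / 2))\<^sup>2)"
proof -
  let ?C = "schur_const \<alpha> ((1 + \<alpha>) / p)"
  have le: "maximal_bergman_norm p \<alpha> \<le> ennreal ?C"
    using assms by (intro maximal_bergman_norm_le) auto
  \<comment> \<open>By the upper bound the norm is finite, so the norm itself can serve as the bound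
    \<open>B\<close> in the lower estimate.\<close>
  then obtain B where B: "B \<ge> 0" "maximal_bergman_norm p \<alpha> = ennreal B"
    by (cases "maximal_bergman_norm p \<alpha>") (auto simp: top_unique)
  then have "?C \<le> B"
    using assms by (intro schur_const_le_maximal_bergman_norm) auto
  then have "maximal_bergman_norm p \<alpha> = ennreal ?C"
    using le B by (intro antisym) (auto intro: ennreal_leI)
  moreover have "(1 + \<alpha>) / q = 1 + \<alpha> - (1 + \<alpha>) / p"
    unfolding assms(3) using assms(1) by (simp add: field_simps)
  ultimately show ?thesis
    by (simp add: schur_const_def)
qed

end
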